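(* Let $G$ be any connected graph and let $U\subseteq V(G)$ be any vertex set. Then the following two assertions are complementary, i.e., exactly one of them holds: (i) $G$ contains an undominating star attached to $U$; (ii) $G$ has a tame star-decomposition such that $U$ is contained in the central part and every critical vertex set of $G$ lives in a leaf's part.
   Context: Graphs may be infinite of arbitrary cardinality. A comb is the union of a ray $R$ with infinitely many disjoint finite paths (possibly trivial) that have precisely their first vertex on $R$; the last vertices of these paths are the teeth of the comb. A star attached to $U$ is a subdivided infinite star all of whose leaves lie in $U$. A subdivided infinite star $S$ dominates a comb $C$ if infinitely many of the leaves of $S$ are also teeth of $C$. A subdivided star $S\subseteq G$ is dominating in $G$ if it dominates some comb $C\subseteq G$, and it is undominating in $G$ otherwise. For a finite $X\subseteq V(G)$ let $\mathscr{C}_X$ be the set of components of $G-X$ and $\breve{\mathscr{C}}_X:=\{C\in\mathscr{C}_X : N(C)=X\}$. A finite $X\subseteq V(G)$ is a critical vertex set of $G$ if $\breve{\mathscr{C}}_X$ is infinite. A separation of $G$ is an unordered pair $\{A,B\}$ with $A\cup B=V(G)$ and no edge of $G$ between $A\setminus B$ and $B\setminus A$; its order is $|A\cap B|$. For finite $X$ and $\mathscr{C}\subseteq\mathscr{C}_X$, $\{X,\mathscr{C}\}$ denotes the separation $\{V(G)\setminus V[\mathscr{C}],\,X\cup V[\mathscr{C}]\}$, where $V[\mathscr{C}]=\bigcup_{C\in\mathscr{C}}V(C)$; every finite-order separation is of this form. A finite-order separation $\{X,\mathscr{C}\}$ is tame if for no $Y\subseteq X$ both $\mathscr{C}$ and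 $\mathscr{C}_X\setminus\mathscr{C}$ contain infinitely many components whose neighbourhoods are precisely equal to $Y$. Equivalently, every critical vertex set $X$ together with all but finitely many components from $\breve{\mathscr{C}}_X$ is contained in one side of the separation. A star-decomposition is a tree-decomposition $(T,(V_t)_{t\in T})$ of $G$ whose decomposition tree $T$ is a star; its central part is the part at the centre of $T$, and its leaves' parts are the parts at the leaves of $T$. Every edge $e=t_1t_2$ of $T$ induces the separation $\{A_{t_1},A_{t_2}\}$ of $G$, where $A_{t_i}$ is the union of all parts $V_t$ with $t$ in the component of $T-e$ containing $t_i$. The tree-decomposition is tame if all separations of $G$ induced by edges of $T$ are tame (in particular of finite order). Given a tame tree-decomposition, a critical vertex set $X$ orients each edge $e$ of $T$ towards the endvertex $t_i$ for which $A_{t_i}$ contains $X$ and all but finitely many of the components from $\breve{\mathscr{C}}_X$. If all edges of $T$ are thereby oriented towards a node $t$, then $X$ lives at $t$, or in the part $V_t$. *)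

theory Defs
  imports Main
begin

section \<open>Simple graphs of arbitrary cardinality\<close>

record 'a ugraph =
  verts :: "'a set"
  edges :: "'a set set"

definition graph :: "'a ugraph \<Rightarrow> bool" where
  "graph G \<longleftrightarrow> (\<forall>e\<in>edges G. e \<subseteq> verts G \<and> card e = 2)"

definition adj :: "'a ugraph \<Rightarrow> 'a \<Rightarrow> 'a \<Rightarrow> bool" where
  "adj G u v \<longleftrightarrow> {u, v} \<in> edges G"

definition subgraph :: "'a ugraph \<Rightarrow> 'a ugraph \<Rightarrow> bool" where
  "subgraph H G \<longleftrightarrow> graph H \<and> verts H \<subseteq> verts G \<and> edges H \<subseteq> edges G"

definition graph_Union :: "'a ugraph set \<Rightarrow> 'a ugraph" where
  "graph_Union \<H> = \<lparr>verts = (\<Union>H\<in>\<H>. verts H), edges = (\<Union>H\<in>\<H>. edges H)\<rparr>"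

definition delete_verts :: "'a ugraph \<Rightarrow> 'a set \<Rightarrow> 'a ugraph" where
  "delete_verts G X = \<lparr>verts = verts G - X, edges = {e \<in> edges G. e \<inter> X = {}}\<rparr>"

definition delete_edge :: "'a ugraph \<Rightarrow> 'a set \<Rightarrow> 'a ugraph" where
  "delete_edge G e = \<lparr>verts = verts G, edges = edges G - {e}\<rparr>"

definition neighbourhood :: "'a ugraph \<Rightarrow> 'a set \<Rightarrow> 'a set" where
  "neighbourhood G C = {v \<in> verts G - C. \<exists>u\<in>C. adj G u v}"

text \<open>
  A component is represented by its vertex set; as components are induced subgraphs, no
  information is lost.
\<close>

definition component_of :: "'a ugraph \<Rightarrow> 'a \<Rightarrow> 'a set" where
  "component_of G v = {w \<in> verts G. (adj G)\<^sup>*\<^sup>* v w}"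

definition components :: "'a ugraph \<Rightarrow> 'a set set" where
  "components G = component_of G ` verts G"

definition connected_graph :: "'a ugraph \<Rightarrow> bool" where
  "connected_graph G \<longleftrightarrow>
     verts G \<noteq> {} \<and> (\<forall>u\<in>verts G. \<forall>v\<in>verts G. (adj G)\<^sup>*\<^sup>* u v)"

text \<open>Finite paths are given by their nonempty vertex sequences; a trivial path is \<open>[v]\<close>.\<close>

definition path_in :: "'a ugraph \<Rightarrow> 'a list \<Rightarrow> bool" where
  "path_in G p \<longleftrightarrow> p \<noteq> [] \<and> distinct p \<and> set p \<subseteq> verts G \<and> successively (adj G) p"

definition path_graph :: "'a list \<Rightarrow> 'a ugraph" where
  "path_graph p = \<lparr>verts = set p, edges = {{p ! i, p ! Suc i} | i. Suc i < length p}\<rparr>"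

definition cycle_in :: "'a ugraph \<Rightarrow> 'a list \<Rightarrow> bool" where
  "cycle_in G p \<longleftrightarrow> path_in G p \<and> length p \<ge> 3 \<and> adj G (last p) (hd p)"

definition tree :: "'a ugraph \<Rightarrow> bool" where
  "tree T \<longleftrightarrow> graph T \<and> connected_graph T \<and> (\<nexists>p. cycle_in T p)"

text \<open>
  The star \<open>K\<^bsub>1,\<kappa>\<^esub>\<close>, for any cardinal \<open>\<kappa>\<close>, with a chosen centre.  The centre is made explicit
  because in \<open>K\<^bsub>1,1\<^esub>\<close> it is not determined by the graph.
\<close>

definition star_with_centre :: "'a ugraph \<Rightarrow> 'a \<Rightarrow> bool" where
  "star_with_centre K c \<longleftrightarrow> c \<in> verts K \<and> edges K = {{c, v} | v. v \<in> verts K - {c}}"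


section \<open>Combs and subdivided stars\<close>

definition ray :: "'a ugraph \<Rightarrow> bool" where
  "ray R \<longleftrightarrow> (\<exists>r :: nat \<Rightarrow> 'a. inj r \<and>
     R = \<lparr>verts = range r, edges = {{r n, r (Suc n)} | n. True}\<rparr>)"

text \<open>
  The teeth are not determined by the graph \<open>C\<close> alone (the paths may be trivial), so a comb is
  considered together with its set \<open>D\<close> of teeth.
\<close>

definition comb_with_teeth :: "'a ugraph \<Rightarrow> 'a set \<Rightarrow> bool" where
  "comb_with_teeth C D \<longleftrightarrow> (\<exists>R P.
     ray R \<and>
     infinite P \<and>
     (\<forall>p\<in>P. p \<noteq> [] \<and> distinct p \<and> set p \<inter> verts R = {hd p}) \<and>
     pairwise (\<lambda>p q. set p \<inter> set q = {}) P \<and>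
     C = graph_Union (insert R (path_graph ` P)) \<and>
     D = last ` P)"

text \<open>
  \<open>S\<close> is obtained from \<open>K\<close> by replacing the edges \<open>e\<close> of \<open>K\<close> by internally disjoint paths \<open>P e\<close>;
  the vertices of \<open>K\<close> themselves serve as the branch vertices of \<open>S\<close>.
\<close>

definition subdivision :: "'a ugraph \<Rightarrow> 'a ugraph \<Rightarrow> bool" where
  "subdivision K S \<longleftrightarrow> (\<exists>P :: 'a set \<Rightarrow> 'a list.
     (\<forall>e\<in>edges K. P e \<noteq> [] \<and> distinct (P e) \<and> {hd (P e), last (P e)} = e \<and>
        set (P e) \<inter> verts K = e) \<and>
     pairwise (\<lambda>e f. set (P e) \<inter> set (P f) \<subseteq> verts K) (edges K) \<and>
     S = graph_Union (insert \<lparr>verts = verts K, edges = {}\<rparr> ((\<lambda>e. path_graph (P e)) ` edges K)))"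

definition subdivided_infinite_star :: "'a ugraph \<Rightarrow> bool" where
  "subdivided_infinite_star S \<longleftrightarrow>
     (\<exists>K c. star_with_centre K c \<and> infinite (verts K) \<and> subdivision K S)"

definition leaves :: "'a ugraph \<Rightarrow> 'a set" where
  "leaves S = {v \<in> verts S. card {e \<in> edges S. v \<in> e} = 1}"

definition star_attached_to :: "'a ugraph \<Rightarrow> 'a set \<Rightarrow> bool" where
  "star_attached_to S U \<longleftrightarrow> subdivided_infinite_star S \<and> leaves S \<subseteq> U"

definition dominating_in :: "'a ugraph \<Rightarrow> 'a ugraph \<Rightarrow> bool" where
  "dominating_in G S \<longleftrightarrow>
     (\<exists>C D. comb_with_teeth C D \<and> subgraph C G \<and> infinite (leaves S \<inter> D))"


section \<open>Critical vertex sets and tame separations\<close>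

definition comps :: "'a ugraph \<Rightarrow> 'a set \<Rightarrow> 'a set set" where
  "comps G X = components (delete_verts G X)"

definition full_comps :: "'a ugraph \<Rightarrow> 'a set \<Rightarrow> 'a set set" where
  "full_comps G X = {C \<in> comps G X. neighbourhood G C = X}"

definition critical :: "'a ugraph \<Rightarrow> 'a set \<Rightarrow> bool" where
  "critical G X \<longleftrightarrow> X \<subseteq> verts G \<and> finite X \<and> infinite (full_comps G X)"

text \<open>A separation is the unordered pair of its sides, so its order is the size of \<open>\<Inter>s\<close>.\<close>

definition separation :: "'a ugraph \<Rightarrow> 'a set set \<Rightarrow> bool" where
  "separation G s \<longleftrightarrow> (\<exists>A B. s = {A, B} \<and> A \<union> B = verts G \<and>
     (\<forall>a\<in>A - B. \<forall>b\<in>B - A. \<not> adj G a b))"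

definition finite_order_separation :: "'a ugraph \<Rightarrow> 'a set set \<Rightarrow> bool" where
  "finite_order_separation G s \<longleftrightarrow> separation G s \<and> finite (\<Inter>s)"

definition comps_separation :: "'a ugraph \<Rightarrow> 'a set \<Rightarrow> 'a set set \<Rightarrow> 'a set set" where
  "comps_separation G X \<C> = {verts G - \<Union>\<C>, X \<union> \<Union>\<C>}"

text \<open>
  \<open>s\<close> determines \<open>X = \<Inter>s\<close>, and determines \<open>\<C>\<close> up to exchanging it with its complement in
  \<open>comps G X\<close>, under which the last condition is symmetric.
\<close>

definition tame_separation :: "'a ugraph \<Rightarrow> 'a set set \<Rightarrow> bool" where
  "tame_separation G s \<longleftrightarrow> finite_order_separation G s \<and> (\<exists>X \<C>.
     X \<subseteq> verts G \<and> finite X \<and> \<C> \<subseteq> comps G X \<and> s = comps_separation G X \<C> \<and>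
     \<not> (\<exists>Y\<subseteq>X. infinite {C \<in> \<C>. neighbourhood G C = Y} \<and>
              infinite {C \<in> comps G X - \<C>. neighbourhood G C = Y}))"


section \<open>Tree-decompositions\<close>

definition tree_decomposition :: "'a ugraph \<Rightarrow> 'b ugraph \<Rightarrow> ('b \<Rightarrow> 'a set) \<Rightarrow> bool" where
  "tree_decomposition G T V \<longleftrightarrow>
     tree T \<and>
     (\<Union>t\<in>verts T. V t) = verts G \<and>
     (\<forall>e\<in>edges G. \<exists>t\<in>verts T. e \<subseteq> V t) \<and>
     (\<forall>p. path_in T p \<longrightarrow> (\<forall>t\<in>set p. V (hd p) \<inter> V (last p) \<subseteq> V t))"

text \<open>The side \<open>A\<^bsub>t\<^esub>\<close> of the separation induced by the edge \<open>e\<close> of \<open>T\<close>, for an endvertex \<open>t\<close> of \<open>e\<close>.\<close>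

definition edge_side :: "'b ugraph \<Rightarrow> ('b \<Rightarrow> 'a set) \<Rightarrow> 'b set \<Rightarrow> 'b \<Rightarrow> 'a set" where
  "edge_side T V e t = (\<Union>u\<in>component_of (delete_edge T e) t. V u)"

definition tame_tree_decomposition ::
    "'a ugraph \<Rightarrow> 'b ugraph \<Rightarrow> ('b \<Rightarrow> 'a set) \<Rightarrow> bool" where
  "tame_tree_decomposition G T V \<longleftrightarrow> tree_decomposition G T V \<and>
     (\<forall>t\<^sub>1 t\<^sub>2. adj T t\<^sub>1 t\<^sub>2 \<longrightarrow>
        tame_separation G {edge_side T V {t\<^sub>1, t\<^sub>2} t\<^sub>1, edge_side T V {t\<^sub>1, t\<^sub>2} t\<^sub>2})"

definition orients_towards ::
    "'a ugraph \<Rightarrow> 'b ugraph \<Rightarrow> ('b \<Rightarrow> 'a set) \<Rightarrow> 'a set \<Rightarrow> 'b set \<Rightarrow> 'b \<Rightarrow> bool" where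
  "orients_towards G T V X e t \<longleftrightarrow>
     X \<subseteq> edge_side T V e t \<and> finite {C \<in> full_comps G X. \<not> C \<subseteq> edge_side T V e t}"

text \<open>An edge \<open>t\<^sub>1t\<^sub>2\<close> points towards \<open>t\<close> iff it is oriented towards the end on the side of \<open>t\<close>.\<close>

definition lives_at ::
    "'a ugraph \<Rightarrow> 'b ugraph \<Rightarrow> ('b \<Rightarrow> 'a set) \<Rightarrow> 'a set \<Rightarrow> 'b \<Rightarrow> bool" where
  "lives_at G T V X t \<longleftrightarrow> t \<in> verts T \<and>
     (\<forall>t\<^sub>1 t\<^sub>2. adj T t\<^sub>1 t\<^sub>2 \<and> t \<in> component_of (delete_edge T {t\<^sub>1, t\<^sub>2}) t\<^sub>1 \<longrightarrow>
        orients_towards G T V X {t\<^sub>1, t\<^sub>2} t\<^sub>1)"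

definition star_decomposition ::
    "'a ugraph \<Rightarrow> 'b ugraph \<Rightarrow> 'b \<Rightarrow> ('b \<Rightarrow> 'a set) \<Rightarrow> bool" where
  "star_decomposition G T c V \<longleftrightarrow> tree_decomposition G T V \<and> star_with_centre T c"

text \<open>
  The decomposition required in the second alternative, with centre \<open>c\<close>; the leaves of the
  star \<open>T\<close> are its nodes other than \<open>c\<close>.
\<close>

definition tame_star_decomposition_for ::
    "'a ugraph \<Rightarrow> 'a set \<Rightarrow> 'b ugraph \<Rightarrow> 'b \<Rightarrow> ('b \<Rightarrow> 'a set) \<Rightarrow> bool" where
  "tame_star_decomposition_for G U T c V \<longleftrightarrow>
     star_decomposition G T c V \<and> tame_tree_decomposition G T V \<and>
     U \<subseteq> V c \<and>
     (\<forall>X. critical G X \<longrightarrow> (\<exists>l\<in>verts T - {c}. lives_at G T V X l))"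

end

theory Submission
  imports Defs
begin

text \<open>
  Both alternatives are controlled by the condition that for every critical vertex set \<open>X\<close> only
  finitely many components in \<open>full_comps G X\<close> meet \<open>U\<close>.

  If it fails for \<open>X\<close>, paths from a vertex of \<open>X\<close> into infinitely many of these components form an
  undominating star.  Conversely, an infinite set \<open>L\<close> to which no comb is attached, such as the set of
  leaves of an undominating star, meets infinitely many components in \<open>full_comps G X\<close> for some
  critical \<open>X\<close>, which cannot happen with a decomposition as in (ii): almost all of these components
  would lie in one leaf's part and hit its finite intersection with the central part.

  If the condition holds, drop from \<open>full_comps G X\<close> the finitely many components that meet \<open>U\<close> or
  contain one of finitely many roots, where a root is chosen once and for all in each component of
  \<open>G - S\<close> for each finite \<open>S\<close>.  The unions of the remaining components form a laminar family, and it
  has no infinite ascending chain with boundaries of bounded size.  Hence each cluster of nested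
  regions is exhausted by a sequence \<open>R\<^sub>0 \<subseteq> R\<^sub>1 \<subseteq> \<dots>\<close> of regions, and the differences of consecutive
  ones, with their finite neighbourhoods, are the leaves' parts.
\<close>

section \<open>Components\<close>

text \<open>The leaves' parts of a star overlap only in the centre and each is cut off by a finite
  set, so the regions have to become disjoint while keeping finite boundaries. Nothing makes the
  neighbourhood of a whole cluster finite, so a cluster cannot simply become one leaf. The boundary
  of \<open>region X\<close> is the finite set \<open>X\<close>, and its size is used as an index:
  among the regions above a fixed one, those with at most \<open>k\<close> boundary vertices have a
  largest member, and every region above the fixed one lies below such a member for some
  \<open>k\<close>. Countably many cuts therefore suffice for a cluster of any cardinality. The
  roots do two jobs. They break the tie between two critical vertex sets that point at each other,
  and they stop ascending chains with bounded boundaries. Both uses concern sets \<open>S\<close>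
  that cannot be told from one critical vertex set alone, so a root is fixed beforehand for every
  \<open>S\<close>.\<close>

abbreviation reach :: "'a ugraph \<Rightarrow> 'a set \<Rightarrow> 'a \<Rightarrow> 'a \<Rightarrow> bool" where
  "reach G X \<equiv> (adj (delete_verts G X))\<^sup>*\<^sup>*"

lemma adj_sym: "adj G u v \<Longrightarrow> adj G v u"
  by (simp add: adj_def insert_commute)

lemma adj_verts:
  assumes "graph G" "adj G u v"
  shows "u \<in> verts G" "v \<in> verts G" "u \<noteq> v"
  using assms by (fastforce simp: graph_def adj_def)+

lemma adj_delete_verts [simp]:
  "adj (delete_verts G X) u v \<longleftrightarrow> adj G u v \<and> u \<notin> X \<and> v \<notin> X"
  by (auto simp: adj_def delete_verts_def)

lemma verts_delete_verts [simp]: "verts (delete_verts G X) = verts G - X"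
  by (simp add: delete_verts_def)

lemma delete_verts_empty [simp]: "delete_verts G {} = G"
  by (simp add: delete_verts_def)

lemma reach_sym: "reach G X u v \<Longrightarrow> reach G X v u"
proof (induction rule: rtranclp_induct)
  case (step y z)
  then have "adj (delete_verts G X) z y" by (auto dest: adj_sym)
  then show ?case using step.IH by (rule converse_rtranclp_into_rtranclp)
qed simp

lemma reach_mono:
  assumes "reach G X u v" "Y \<subseteq> X"
  shows "reach G Y u v"
  using assms(1) by (rule rtranclp_mono[THEN predicate2D, rotated]) (use assms(2) in auto)

text \<open>Reflexivity makes \<open>reach G X u u\<close> true even for \<open>u\<close> in
  \<open>X\<close>; vertices of \<open>X\<close> occur in no other way.\<close>

lemma reach_notin: "reach G X u v \<Longrightarrow> u \<noteq> v \<Longrightarrow> u \<notin> X \<and> v \<notin> X"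
proof (induction rule: rtranclp_induct)
  case (step y z)
  then show ?case by (cases "u = y") auto
qed simp

lemma reach_verts:
  assumes "graph G" "reach G X u v" "u \<in> verts G"
  shows "v \<in> verts G"
  using assms(2,3)
proof (induction rule: rtranclp_induct)
  case (step y z)
  then show ?case using adj_verts(2)[OF assms(1), of y z] by simp
qed

lemma reach_closed:
  assumes "reach G X u v" "u \<in> A" "\<And>a b. a \<in> A \<Longrightarrow> adj G a b \<Longrightarrow> b \<notin> X \<Longrightarrow> b \<in> A"
  shows "v \<in> A"
  using assms(1,2) by (induction rule: rtranclp_induct) (auto dest: assms(3))

lemma comps_iff:
  "C \<in> comps G X \<longleftrightarrow> (\<exists>v\<in>verts G - X. C = {w \<in> verts G - X. reach G X v w})"
  by (auto simp: comps_def components_def component_of_def)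

lemma comps_cover: "v \<in> verts G - X \<Longrightarrow> \<exists>C\<in>comps G X. v \<in> C"
  by (rule bexI[of _ "{w \<in> verts G - X. reach G X v w}"]) (auto simp: comps_iff)

lemma comps_subset: "C \<in> comps G X \<Longrightarrow> C \<subseteq> verts G - X"
  by (auto simp: comps_iff)

lemma comps_nonempty: "C \<in> comps G X \<Longrightarrow> C \<noteq> {}"
  by (auto simp: comps_iff)

lemma comps_reach: "C \<in> comps G X \<Longrightarrow> u \<in> C \<Longrightarrow> v \<in> C \<Longrightarrow> reach G X u v"
  unfolding comps_iff using reach_sym[of G X] rtranclp_trans[of "adj (delete_verts G X)"] by blast

lemma comps_absorb:
  assumes "graph G" "C \<in> comps G X" "u \<in> C" "reach G X u v"
  shows "v \<in> C"
proof -
  obtain w where w: "w \<in> verts G - X" "C = {y \<in> verts G - X. reach G X w y}"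
    using assms(2) by (auto simp: comps_iff)
  then have "reach G X w v" "u \<in> verts G - X" using assms(3,4) by auto
  moreover have "v \<in> verts G - X"
    using reach_verts[OF assms(1,4)] reach_notin[OF assms(4)] \<open>u \<in> verts G - X\<close> by blast
  ultimately show ?thesis using w by simp
qed

lemma comps_adj:
  assumes "graph G" "C \<in> comps G X" "u \<in> C" "adj G u v" "v \<notin> X"
  shows "v \<in> C"
proof (rule comps_absorb[OF assms(1-3)])
  show "reach G X u v" using assms comps_subset[OF assms(2)] by (intro r_into_rtranclp) auto
qed

lemma comps_eqI:
  assumes "graph G" "C \<in> comps G X" "D \<in> comps G X" "u \<in> C" "u \<in> D"
  shows "C = D"
proof
  show "C \<subseteq> D" using comps_absorb[OF assms(1,3,5)] comps_reach[OF assms(2,4)] by blast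
  show "D \<subseteq> C" using comps_absorb[OF assms(1,2,4)] comps_reach[OF assms(3,5)] by blast
qed

lemma comps_disjoint: "graph G \<Longrightarrow> C \<in> comps G X \<Longrightarrow> D \<in> comps G X \<Longrightarrow> C \<noteq> D \<Longrightarrow> C \<inter> D = {}"
  using comps_eqI[of G C X D] by blast

lemma comps_absorb_subset:
  assumes "graph G" "C \<in> comps G X" "D \<in> comps G Y" "u \<in> C" "u \<in> D" "C \<inter> Y = {}"
  shows "C \<subseteq> D"
proof
  fix v assume "v \<in> C"
  then have "reach G X u v" using assms comps_reach by metis
  then have "v \<in> C \<and> v \<in> D"
  proof (induction rule: rtranclp_induct)
    case base then show ?case using assms by simp
  next
    case (step y z)
    then have "z \<in> C" using comps_adj[OF assms(1,2), of y z] by auto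
    then show ?case using comps_adj[OF assms(1,3), of y z] step assms(6) by auto
  qed
  then show "v \<in> D" by simp
qed

lemma neighbourhood_comps: "graph G \<Longrightarrow> C \<in> comps G X \<Longrightarrow> neighbourhood G C \<subseteq> X"
  unfolding neighbourhood_def using comps_adj[of G C X] by blast

text \<open>Edges leave \<open>C\<close> only into \<open>Y\<close>, so restoring the vertices of
  \<open>X - Y\<close> does not enlarge it. Components of \<open>G - X\<close> with a common
  neighbourhood thereby become full components of that smaller set.\<close>

lemma comps_neighbourhood:
  assumes "graph G" "C \<in> comps G X" "neighbourhood G C \<subseteq> Y" "Y \<subseteq> X"
  shows "C \<in> comps G Y"
proof -
  obtain u where u: "u \<in> C" using comps_nonempty[OF assms(2)] by blast
  have sub: "C \<subseteq> verts G - X" by (rule comps_subset[OF assms(2)])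
  then have "u \<in> verts G - Y" using u assms(4) by blast
  then obtain D where D: "D \<in> comps G Y" "u \<in> D" using comps_cover[of u G Y] by auto
  have "C \<subseteq> D" using comps_absorb_subset[OF assms(1,2) D(1) u D(2)] sub assms(4) by blast
  moreover have "D \<subseteq> C"
  proof
    fix v assume "v \<in> D"
    then have "reach G Y u v" using D comps_reach by metis
    then show "v \<in> C"
    proof (rule reach_closed[OF _ u])
      fix a b assume "a \<in> C" "adj G a b" "b \<notin> Y"
      then show "b \<in> C" using assms(3) adj_verts[OF assms(1), of a b]
        by (auto simp: neighbourhood_def)
    qed
  qed
  ultimately show ?thesis using D by simp
qed

lemma finite_disjoint_meeting:
  assumes "finite F" "\<And>i j. i \<in> A \<Longrightarrow> j \<in> A \<Longrightarrow> i \<noteq> j \<Longrightarrow> f i \<inter> f j = {}"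
  shows "finite {i \<in> A. f i \<inter> F \<noteq> {}}"
proof (rule inj_on_finite[OF _ _ assms(1)])
  let ?g = "\<lambda>i. SOME x. x \<in> f i \<inter> F"
  have g: "?g i \<in> f i \<inter> F" if "i \<in> {i \<in> A. f i \<inter> F \<noteq> {}}" for i
    using that someI_ex[of "\<lambda>x. x \<in> f i \<inter> F"] by blast
  then show "?g ` {i \<in> A. f i \<inter> F \<noteq> {}} \<subseteq> F" by blast
  show "inj_on ?g {i \<in> A. f i \<inter> F \<noteq> {}}"
  proof (rule inj_onI)
    fix i j assume i: "i \<in> {i \<in> A. f i \<inter> F \<noteq> {}}" and j: "j \<in> {i \<in> A. f i \<inter> F \<noteq> {}}"
      and eq: "?g i = ?g j"
    then have "?g i \<in> f i \<inter> f j" using g[OF i] g[OF j] by simp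
    then show "i = j" using assms(2)[of i j] i j by blast
  qed
qed

lemma finite_comps_meeting:
  assumes "graph G" "finite F"
  shows "finite {C \<in> comps G X. C \<inter> F \<noteq> {}}"
  by (rule finite_disjoint_meeting[OF assms(2)]) (rule comps_disjoint[OF assms(1)])

lemma full_compsD:
  assumes "C \<in> full_comps G X"
  shows "C \<in> comps G X" "neighbourhood G C = X" "x \<in> X \<Longrightarrow> \<exists>c\<in>C. adj G c x"
  using assms by (auto simp: full_comps_def neighbourhood_def)

lemma finite_full_comps_meeting:
  "graph G \<Longrightarrow> finite F \<Longrightarrow> finite {C \<in> full_comps G X. C \<inter> F \<noteq> {}}"
  by (rule finite_subset[OF _ finite_comps_meeting[of G F X]]) (auto simp: full_comps_def)

text \<open>Every vertex of \<open>X\<close> has a neighbour in \<open>C\<close>, so a full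
  component avoiding \<open>Y\<close> connects all of \<open>X\<close> outside
  \<open>Y\<close>.\<close>

lemma full_comps_reach:
  assumes "graph G" "C \<in> full_comps G X" "C \<inter> Y = {}" "a \<in> C \<union> X - Y" "b \<in> C \<union> X - Y"
  shows "reach G Y a b"
proof -
  have C: "C \<in> comps G X" using assms full_compsD by metis
  have inner: "reach G Y u v" if uv: "u \<in> C" "v \<in> C" for u v
  proof -
    obtain D where D: "D \<in> comps G Y" "u \<in> D"
      using comps_cover[of u G Y] comps_subset[OF C] uv assms(3) by blast
    then have "v \<in> D" using comps_absorb_subset[OF assms(1) C D(1) uv(1)] uv assms(3) by blast
    then show ?thesis using D comps_reach by metis
  qed
  have *: "\<exists>c\<in>C. reach G Y a c" if a: "a \<in> C \<union> X - Y" for a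
  proof (cases "a \<in> C")
    case False
    then have "a \<in> X" using a by blast
    then obtain c where "c \<in> C" "adj G c a" using full_compsD(3)[OF assms(2), of a] by blast
    then have "adj (delete_verts G Y) a c" using assms(3) a adj_sym[of G c a] by auto
    then show ?thesis using \<open>c \<in> C\<close> by blast
  qed auto
  obtain c d where "c \<in> C" "d \<in> C" "reach G Y a c" "reach G Y b d"
    using *[OF assms(4)] *[OF assms(5)] by blast
  then show ?thesis using inner reach_sym by (meson rtranclp_trans)
qed

text \<open>A finite \<open>X\<close> has finitely many subsets, so infinitely many of the
  components share one neighbourhood \<open>Y\<close>.\<close>

lemma infinite_comps_critical:
  assumes "graph G" "finite X" "infinite {C \<in> comps G X. C \<inter> L \<noteq> {}}"
  shows "\<exists>Y. critical G Y \<and> infinite {C \<in> full_comps G Y. C \<inter> L \<noteq> {}}"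
proof -
  let ?A = "{C \<in> comps G X. C \<inter> L \<noteq> {}}"
  have "neighbourhood G ` ?A \<subseteq> Pow X" using neighbourhood_comps[OF assms(1)] by blast
  then have "finite (neighbourhood G ` ?A)" using assms(2) finite_subset by blast
  then obtain C where C: "C \<in> ?A"
    and inf: "infinite {D \<in> ?A. neighbourhood G D = neighbourhood G C}"
    using pigeonhole_infinite[OF assms(3)] by blast
  define Y where "Y = neighbourhood G C"
  have "Y \<subseteq> X" using neighbourhood_comps[OF assms(1)] C by (auto simp: Y_def)
  have "{D \<in> ?A. neighbourhood G D = neighbourhood G C} \<subseteq> {C \<in> full_comps G Y. C \<inter> L \<noteq> {}}"
    using comps_neighbourhood[OF assms(1)] \<open>Y \<subseteq> X\<close> by (auto simp: full_comps_def Y_def)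
  then have inf': "infinite {C \<in> full_comps G Y. C \<inter> L \<noteq> {}}" using inf finite_subset by blast
  moreover have "{C \<in> full_comps G Y. C \<inter> L \<noteq> {}} \<subseteq> full_comps G Y" by blast
  then have "infinite (full_comps G Y)" using inf' finite_subset by blast
  ultimately have "critical G Y" using \<open>Y \<subseteq> X\<close> assms(2) finite_subset
    by (auto simp: critical_def Y_def neighbourhood_def)
  then show ?thesis using inf' by blast
qed

section \<open>Laminar regions of critical vertex sets\<close>

locale finitely_met =
  fixes G :: "'a ugraph" and U :: "'a set"
  assumes graph: "graph G"
    and connected: "connected_graph G"
    and finite_met: "critical G X \<Longrightarrow> finite {C \<in> full_comps G X. C \<inter> U \<noteq> {}}"
begin

text \<open>The choice is made from the component and not from \<open>x\<close>, so all vertices of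
  one component of \<open>G - S\<close> share their root.\<close>

definition root :: "'a set \<Rightarrow> 'a \<Rightarrow> 'a" where
  "root S x = (SOME r. r \<in> component_of (delete_verts G S) x)"

text \<open>All proper subsets \<open>S\<close> are treated alike because those used later,
  \<open>X \<inter> P\<close> and the limit of a sequence of boundaries, depend on more than
  \<open>X\<close>. For finite \<open>X\<close> this excludes only finitely many roots.\<close>

definition good_comps :: "'a set \<Rightarrow> 'a set set" where
  "good_comps X = {C \<in> full_comps G X. C \<inter> U = {} \<and> (\<forall>S x. S \<subset> X \<longrightarrow> x \<in> X - S \<longrightarrow> root S x \<notin> C)}"

definition region :: "'a set \<Rightarrow> 'a set" where
  "region X = \<Union>(good_comps X)"

lemma root_in:
  assumes "x \<in> verts G - S"
  shows "root S x \<in> component_of (delete_verts G S) x"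
proof -
  have "x \<in> component_of (delete_verts G S) x" using assms by (simp add: component_of_def)
  then show ?thesis unfolding root_def by (rule someI)
qed

lemma root_eq:
  assumes "reach G S x y"
  shows "root S x = root S y"
proof -
  have "reach G S x w \<longleftrightarrow> reach G S y w" for w
    using rtranclp_trans[OF assms, of w] rtranclp_trans[OF reach_sym[OF assms], of w] by blast
  then show ?thesis by (simp add: root_def component_of_def)
qed

lemma good_compsD:
  assumes "C \<in> good_comps X"
  shows "C \<in> full_comps G X" "C \<in> comps G X" "C \<inter> U = {}" "neighbourhood G C = X"
    "S \<subset> X \<Longrightarrow> x \<in> X - S \<Longrightarrow> root S x \<notin> C"
  using assms by (simp_all add: good_comps_def full_comps_def)

lemma cofinite_good_comps:
  assumes "critical G X"
  shows "finite (full_comps G X - good_comps X)"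
proof -
  have fin: "finite X" using assms by (simp add: critical_def)
  let ?R = "(\<lambda>(S, x). root S x) ` (Pow X \<times> X)"
  have "full_comps G X - good_comps X \<subseteq>
      {C \<in> full_comps G X. C \<inter> U \<noteq> {}} \<union> {C \<in> full_comps G X. C \<inter> ?R \<noteq> {}}"
    by (fastforce simp: good_comps_def)
  moreover have "finite {C \<in> full_comps G X. C \<inter> ?R \<noteq> {}}"
    by (rule finite_full_comps_meeting[OF graph]) (use fin in simp)
  ultimately show ?thesis using finite_met[OF assms] finite_subset by blast
qed

lemma infinite_good_comps: "critical G X \<Longrightarrow> infinite (good_comps X)"
  using cofinite_good_comps[of X] by (auto simp: critical_def good_comps_def)

lemma good_comp_avoiding:
  assumes "critical G X" "finite F"
  obtains C where "C \<in> good_comps X" "C \<inter> F = {}"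
proof -
  have "finite {C \<in> good_comps X. C \<inter> F \<noteq> {}}"
    by (rule finite_subset[OF _ finite_full_comps_meeting[OF graph assms(2), of X]])
      (auto simp: good_comps_def)
  then have "\<not> good_comps X \<subseteq> {C \<in> good_comps X. C \<inter> F \<noteq> {}}"
    using infinite_good_comps[OF assms(1)] finite_subset by blast
  then show thesis using that by blast
qed

text \<open>Of infinitely many disjoint full components one avoids \<open>Y\<close> and connects
  \<open>x\<close> with \<open>y\<close>: no finite set separates a critical vertex set.\<close>

lemma critical_reach:
  assumes "critical G X" "finite Y" "x \<in> X - Y" "y \<in> X - Y"
  shows "reach G Y x y"
proof -
  obtain C where "C \<in> good_comps X" "C \<inter> Y = {}" using good_comp_avoiding assms(1,2) by metis
  then show ?thesis using full_comps_reach[OF graph, of C X Y x y] good_compsD(1) assms(3,4) by blast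
qed

lemma region_nonempty: "critical G X \<Longrightarrow> region X \<noteq> {}"
  using good_comp_avoiding[of X "{}"] good_compsD(2) comps_nonempty
  by (metis region_def Union_upper finite.emptyI subset_empty)

lemma region_subset: "region X \<subseteq> verts G - X - U"
  using good_compsD(2,3) comps_subset by (fastforce simp: region_def)

lemma neighbourhood_region:
  assumes "critical G X"
  shows "neighbourhood G (region X) = X"
proof
  show "neighbourhood G (region X) \<subseteq> X"
    using comps_adj[OF graph] good_compsD(2) unfolding neighbourhood_def region_def by blast
  obtain C where C: "C \<in> good_comps X" using good_comp_avoiding[OF assms] by blast
  show "X \<subseteq> neighbourhood G (region X)"
  proof
    fix x assume "x \<in> X"
    then obtain c where "c \<in> C" "adj G c x" using full_compsD(3) good_compsD(1)[OF C] by metis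
    moreover have "x \<in> verts G - region X"
      using \<open>x \<in> X\<close> assms region_subset by (auto simp: critical_def)
    ultimately show "x \<in> neighbourhood G (region X)"
      using C unfolding neighbourhood_def region_def by blast
  qed
qed

section \<open>Relative position of two critical vertex sets\<close>

lemma full_comp_subset:
  assumes "C \<in> full_comps G P" "C \<inter> X = {}" "p \<in> P - X" "A \<in> comps G X" "p \<in> A"
  shows "C \<subseteq> A"
proof
  fix c assume "c \<in> C"
  then have "reach G X p c"
    using full_comps_reach[OF graph assms(1,2), of p c] assms(2,3) by blast
  then show "c \<in> A" using comps_absorb[OF graph assms(4,5)] by blast
qed

lemma selected_comp:
  assumes "critical G P" "finite X" "\<not> P \<subseteq> X"
  obtains A where "A \<in> comps G X" "P - X \<subseteq> A" "P - X \<noteq> {}"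
proof -
  obtain p where p: "p \<in> P - X" using assms by blast
  then obtain A where A: "A \<in> comps G X" "p \<in> A"
    using assms(1) comps_cover[of p G X] by (auto simp: critical_def)
  have "P - X \<subseteq> A"
    using critical_reach[OF assms(1,2) p] comps_absorb[OF graph A] by blast
  then show thesis using that A p by blast
qed

text \<open>For incomparable \<open>X\<close> and \<open>P\<close>, each selects a component outside
  the other: \<open>A\<close> contains \<open>P - X\<close> and \<open>B\<close> contains
  \<open>X - P\<close>. All good components of \<open>X\<close> except possibly \<open>A\<close> lie
  in \<open>B\<close>, and conversely, so only the case that \<open>A\<close> and \<open>B\<close>
  are both good could fail. Roots rule it out.\<close>

lemma region_trichotomy:
  assumes "critical G X" "critical G P" "X \<noteq> P"
  shows "(\<exists>B\<in>good_comps P. region X \<subseteq> B) \<or> (\<exists>A\<in>good_comps X. region P \<subseteq> A) \<or>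
    region X \<inter> region P = {}"
proof -
  have fin: "finite X" "finite P" using assms by (auto simp: critical_def)
  have nested: "(\<exists>A\<in>good_comps X. region P \<subseteq> A) \<or> region X \<inter> region P = {}"
    if sub: "X \<subset> P" and X: "critical G X" and P: "critical G P" for X P
  proof -
    have "finite X" using X by (simp add: critical_def)
    then obtain A where A: "A \<in> comps G X" "P - X \<subseteq> A" "P - X \<noteq> {}"
      using selected_comp[OF P] sub by blast
    have "C \<subseteq> A" if C: "C \<in> good_comps P" for C
    proof -
      have "C \<inter> X = {}" using comps_subset[OF good_compsD(2)[OF C]] sub by blast
      then show ?thesis using full_comp_subset[OF good_compsD(1)[OF C]] A by blast
    qed
    then have "region P \<subseteq> A" by (auto simp: region_def)
    moreover have "region X \<inter> A = {}" if "A \<notin> good_comps X"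
      using comps_disjoint[OF graph _ A(1)] good_compsD(2) that unfolding region_def by blast
    ultimately show ?thesis by blast
  qed
  consider "X \<subset> P" | "P \<subset> X" | "\<not> X \<subseteq> P" "\<not> P \<subseteq> X" using assms(3) by blast
  then show ?thesis
  proof cases
    case 1
    then show ?thesis using nested[of X P] assms by blast
  next
    case 2
    then show ?thesis using nested[of P X] assms by blast
  next
    case 3
    obtain A where A: "A \<in> comps G X" "P - X \<subseteq> A" "P - X \<noteq> {}"
      using selected_comp[OF assms(2) fin(1)] 3 by metis
    obtain B where B: "B \<in> comps G P" "X - P \<subseteq> B" "X - P \<noteq> {}"
      using selected_comp[OF assms(1) fin(2)] 3 by metis
    \<comment> \<open>Such a component avoids \<open>A\<close>, hence \<open>P\<close>, and attaches
      to \<open>X - P\<close>, which lies in \<open>B\<close>.\<close>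
    have subB: "C \<subseteq> B" if "C \<in> good_comps X" "C \<noteq> A" for C
    proof -
      have "C \<inter> A = {}" using comps_disjoint[OF graph good_compsD(2) A(1)] that by blast
      moreover have "C \<inter> X = {}" using comps_subset[OF good_compsD(2)] that by blast
      ultimately have "C \<inter> P = {}" using A(2) by blast
      then show ?thesis using full_comp_subset[OF good_compsD(1)[OF that(1)]] B by blast
    qed
    have subA: "C \<subseteq> A" if "C \<in> good_comps P" "C \<noteq> B" for C
    proof -
      have "C \<inter> B = {}" using comps_disjoint[OF graph good_compsD(2) B(1)] that by blast
      moreover have "C \<inter> P = {}" using comps_subset[OF good_compsD(2)] that by blast
      ultimately have "C \<inter> X = {}" using B(2) by blast
      then show ?thesis using full_comp_subset[OF good_compsD(1)[OF that(1)]] A by blast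
    qed
    show ?thesis
    proof (cases "A \<in> good_comps X")
      case False
      then have X: "region X \<subseteq> B" using subB by (auto simp: region_def)
      show ?thesis
      proof (cases "B \<in> good_comps P")
        case False
        then have "region P \<inter> B = {}"
          using comps_disjoint[OF graph _ B(1)] good_compsD(2) unfolding region_def by blast
        then show ?thesis using X by blast
      qed (use X in blast)
    next
      case True
      note goodA = True
      show ?thesis
      proof (cases "B \<in> good_comps P")
        case False
        then have "region P \<subseteq> A" using subA by (auto simp: region_def)
        then show ?thesis using True by blast
      next
        case True
        \<comment> \<open>In \<open>G - S\<close> every edge leaving \<open>A\<close> ends in
          \<open>X - P\<close>, inside \<open>B\<close>, and vice versa. So the root common to
          \<open>x\<close> and \<open>p\<close> lies in \<open>A\<close> or in \<open>B\<close>,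
          against the goodness of that component.\<close>
        define S where "S = X \<inter> P"
        obtain x p where x: "x \<in> X - P" and p: "p \<in> P - X" using A B by blast
        have "reach G S x p"
          by (rule full_comps_reach[OF graph good_compsD(1)[OF goodA]])
            (use comps_subset[OF A(1)] x p A(2) in \<open>auto simp: S_def\<close>)
        then have eq: "root S x = root S p" by (rule root_eq)
        have "x \<in> verts G - S" using x assms(1) by (auto simp: S_def critical_def)
        then have "reach G S x (root S x)" using root_in by (simp add: component_of_def)
        then have "root S x \<in> A \<union> B"
        proof (rule reach_closed)
          show "x \<in> A \<union> B" using x B(2) by blast
          fix a b assume "a \<in> A \<union> B" "adj G a b" "b \<notin> S"
          then show "b \<in> A \<union> B"
            using comps_adj[OF graph A(1), of a b] comps_adj[OF graph B(1), of a b] A(2) B(2)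
            by (auto simp: S_def)
        qed
        moreover have "root S x \<notin> A"
          using good_compsD(5)[OF goodA, of S x] x p by (auto simp: S_def)
        moreover have "root S p \<notin> B"
          using good_compsD(5)[OF True, of S p] x p by (auto simp: S_def)
        ultimately show ?thesis using eq by simp
      qed
    qed
  qed
qed

text \<open>A single component in place of the whole region makes the members of an ascending chain
  connected.\<close>

lemma region_psubset:
  assumes "critical G X" "critical G P" "region X \<subset> region P"
  obtains B where "B \<in> good_comps P" "region X \<subseteq> B"
proof -
  have "X \<noteq> P" using assms(3) by blast
  moreover have "\<not> (\<exists>A\<in>good_comps X. region P \<subseteq> A)" using assms(3) by (auto simp: region_def)
  moreover have "region X \<inter> region P \<noteq> {}" using assms region_nonempty by blast
  ultimately show thesis using region_trichotomy[OF assms(1,2)] that by blast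
qed

lemma region_laminar:
  assumes "critical G X" "critical G P"
  shows "region X \<subseteq> region P \<or> region P \<subseteq> region X \<or> region X \<inter> region P = {}"
  using region_trichotomy[OF assms] unfolding region_def by blast

lemma region_comparable:
  assumes "critical G X" "critical G P" "critical G Z" "region Z \<subseteq> region X" "region Z \<subseteq> region P"
  shows "region X \<subseteq> region P \<or> region P \<subseteq> region X"
  using region_laminar[OF assms(1,2)] region_nonempty[OF assms(3)] assms(4,5) by blast

lemma region_subset_boundary:
  assumes "critical G X" "critical G P" "region X \<subseteq> region P"
  shows "X \<subseteq> P \<union> region P"
proof -
  have "neighbourhood G (region X) \<subseteq> region P \<union> neighbourhood G (region P)"
    using assms(3) by (auto simp: neighbourhood_def)
  then show ?thesis using neighbourhood_region assms by blast
qed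

text \<open>
  In such a sequence the boundaries would converge to a finite set \<open>S\<close>, and the root chosen for
  the component of \<open>G - S\<close> containing the sequence would eventually lie in one of the regions.
\<close>

lemma no_bounded_chain:
  fixes X :: "nat \<Rightarrow> 'a set"
  assumes crit: "\<And>i. critical G (X i)" and le: "\<And>i. card (X i) \<le> k"
    and mono: "\<And>i. region (X i) \<subset> region (X (Suc i))"
  shows False
proof -
  have "\<exists>C. C \<in> good_comps (X (Suc i)) \<and> region (X i) \<subseteq> C" for i
    using region_psubset[OF crit crit mono] by metis
  then obtain C where C: "\<And>i. C i \<in> good_comps (X (Suc i))" "\<And>i. region (X i) \<subseteq> C i" by metis
  have "C i \<subseteq> C (Suc i)" for i using C(1)[of i] C(2)[of "Suc i"] by (auto simp: region_def)
  then have Cmono: "C i \<subseteq> C j" if "i \<le> j" for i j using that lift_Suc_mono_le[of C] by simp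
  have finX: "finite (X i)" for i using crit by (simp add: critical_def)
  \<comment> \<open>The lower limit of the boundaries: the vertices in all but finitely many of
    them.\<close>
  define S where "S = {q. \<exists>i. \<forall>j\<ge>i. q \<in> X j}"
  have ev: "\<exists>i. \<forall>j\<ge>i. F \<subseteq> X j" if "finite F" "F \<subseteq> S" for F
    using that
  proof (induction F)
    case (insert q F)
    then obtain i i' where "\<forall>j\<ge>i. F \<subseteq> X j" "\<forall>j\<ge>i'. q \<in> X j" by (auto simp: S_def)
    then have "\<forall>j\<ge>max i i'. insert q F \<subseteq> X j" by simp
    then show ?case by blast
  qed simp
  have "finite S"
  \<comment> \<open>Any finite set of limit vertices lies in one common boundary, so there are at
    most \<open>k\<close> of them.\<close>
  proof (rule ccontr)
    assume "infinite S"
    then obtain F where F: "finite F" "card F = Suc k" "F \<subseteq> S" using infinite_arbitrarily_large by blast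
    then obtain i where "F \<subseteq> X i" using ev[of F] by auto
    then have "card F \<le> card (X i)" by (rule card_mono[OF finX])
    then have "card F \<le> k" using le[of i] by simp
    then show False using F by simp
  qed
  then obtain n where n: "\<And>j. j \<ge> n \<Longrightarrow> S \<subseteq> X j" using ev[of S] by blast
  \<comment> \<open>All good components of \<open>X i\<close> lie in \<open>C i\<close>, which is
    connected outside \<open>X (Suc i)\<close>. If that set contained \<open>X i\<close>, two of
    them would be joined in \<open>G - X i\<close>.\<close>
  have not_sub: "\<not> X i \<subseteq> X (Suc i)" for i
  proof
    assume sub: "X i \<subseteq> X (Suc i)"
    obtain A where A: "A \<in> good_comps (X i)" using good_comp_avoiding[OF crit] by blast
    have "finite {A}" by simp
    then obtain A' where A': "A' \<in> good_comps (X i)" "A' \<noteq> A"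
      using infinite_good_comps[OF crit, of i] by (metis finite_subset insertI1 subsetI singletonI)
    obtain a a' where a: "a \<in> A" "a' \<in> A'"
      using comps_nonempty good_compsD(2) A A'(1) by blast
    then have "a \<in> C i" "a' \<in> C i" using C(2) A A' by (auto simp: region_def)
    then have "reach G (X i) a a'"
      using comps_reach[OF good_compsD(2)[OF C(1)]] reach_mono[OF _ sub] by blast
    then have "a' \<in> A" using comps_absorb[OF graph good_compsD(2)[OF A] a(1)] by blast
    then show False using comps_eqI[OF graph good_compsD(2)[OF A] good_compsD(2)[OF A'(1)]] a A' by blast
  qed
  \<comment> \<open>Equality \<open>S = X j\<close> would put \<open>X j\<close> inside
    \<open>X (Suc j)\<close>.\<close>
  have psub: "S \<subset> X j" if "j \<ge> n" for j using n[OF that] n[of "Suc j"] not_sub[of j] that by auto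
  obtain c where c: "c \<in> C n" using C(1) good_compsD(2) comps_nonempty by blast
  define r where "r = root S c"
  \<comment> \<open>Outside \<open>S\<close>, the component \<open>C j\<close> links
    \<open>c\<close> to a vertex of \<open>X (Suc j) - S\<close>, so goodness of \<open>C j\<close>
    forbids it to contain the root of \<open>c\<close>.\<close>
  have rC: "r \<notin> C j" if j: "j \<ge> n" for j
  proof -
    obtain x where x: "x \<in> X (Suc j) - S" using psub[of "Suc j"] j by auto
    have "C j \<inter> X (Suc j) = {}" using comps_subset[OF good_compsD(2)[OF C(1)]] by blast
    then have "C j \<inter> S = {}" using n[of "Suc j"] j by auto
    moreover have "c \<in> C j" using c Cmono[OF j] by blast
    ultimately have "reach G S x c"
      using full_comps_reach[OF graph good_compsD(1)[OF C(1)[of j]], of S x c] x by blast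
    then have "root S x = r" unfolding r_def by (rule root_eq)
    then show ?thesis using good_compsD(5)[OF C(1)[of j], of S x] x psub[of "Suc j"] j by auto
  qed
  have "c \<in> verts G - X (Suc n)" using comps_subset[OF good_compsD(2)[OF C(1)]] c by blast
  then have "c \<in> verts G - S" using n[of "Suc n"] by auto
  then have "reach G S c r" using root_in by (simp add: component_of_def r_def)
  then have "r \<in> (\<Union>j\<in>{n..}. C j)"
  proof (rule reach_closed)
    show "c \<in> (\<Union>j\<in>{n..}. C j)" using c by blast
    fix a b assume "a \<in> (\<Union>j\<in>{n..}. C j)" and ab: "adj G a b" "b \<notin> S"
    then obtain i where i: "i \<ge> n" "a \<in> C i" by auto
    \<comment> \<open>A vertex outside \<open>S\<close> is missing from arbitrarily late boundaries.
      Asking for \<open>j \<ge> Suc i\<close> makes \<open>j\<close> a successor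
      \<open>Suc j'\<close>, and \<open>C j'\<close> is a component of \<open>G - X j\<close>
      containing \<open>a\<close>.\<close>
    obtain j where j: "j \<ge> Suc i" "b \<notin> X j" using ab(2) by (auto simp: S_def)
    then obtain j' where j': "j = Suc j'" "j' \<ge> i" by (cases j) auto
    have "b \<in> C j'"
      by (rule comps_adj[OF graph good_compsD(2)[OF C(1)[of j']] _ ab(1)])
        (use i Cmono[OF j'(2)] j j' in auto)
    then show "b \<in> (\<Union>j\<in>{n..}. C j)" using i j' by auto
  qed
  then show False using rC by auto
qed

section \<open>Largest regions with bounded boundary\<close>

definition peak :: "'a set \<Rightarrow> nat \<Rightarrow> 'a set" where
  "peak Z k = (SOME Y. critical G Y \<and> region Z \<subseteq> region Y \<and> card Y \<le> k \<and>
     (\<forall>P. critical G P \<and> region Z \<subseteq> region P \<and> card P \<le> k \<longrightarrow> region P \<subseteq> region Y))"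

text \<open>Regions containing \<open>region Z\<close> are pairwise comparable, so a maximal one
  among those with at most \<open>k\<close> boundary vertices is the largest. Maximal ones exist
  because bounded ascending chains stop.\<close>

lemma peak_spec:
  assumes "critical G Z" "card Z \<le> k"
  shows "critical G (peak Z k)" "region Z \<subseteq> region (peak Z k)" "card (peak Z k) \<le> k"
    "critical G P \<Longrightarrow> region Z \<subseteq> region P \<Longrightarrow> card P \<le> k \<Longrightarrow> region P \<subseteq> region (peak Z k)"
proof -
  define A where "A = {Y. critical G Y \<and> region Z \<subseteq> region Y \<and> card Y \<le> k}"
  \<comment> \<open>Larger regions count as smaller in \<open>R\<close>, so an
    \<open>R\<close>-minimal element has a maximal region.\<close>
  define R where "R = {(P, Y). P \<in> A \<and> Y \<in> A \<and> region Y \<subset> region P}"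
  have "wf R"
    unfolding wf_iff_no_infinite_down_chain
  proof
    assume "\<exists>f. \<forall>i. (f (Suc i), f i) \<in> R"
    then obtain f where "\<And>i. (f (Suc i), f i) \<in> R" by blast
    then show False using no_bounded_chain[of f k] by (auto simp: R_def A_def)
  qed
  moreover have "Z \<in> A" using assms by (simp add: A_def)
  ultimately obtain Y where Y: "Y \<in> A" "\<And>P. (P, Y) \<in> R \<Longrightarrow> P \<notin> A"
    by (rule wfE_min) blast
  have "region P \<subseteq> region Y" if P: "P \<in> A" for P
  proof -
    have "\<not> region Y \<subset> region P" using Y(1) Y(2)[of P] P by (auto simp: R_def)
    moreover have "region P \<subseteq> region Y \<or> region Y \<subseteq> region P"
      using region_comparable[of P Y Z] P Y(1) assms(1) by (simp add: A_def)
    ultimately show ?thesis by blast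
  qed
  then have "\<exists>Y. critical G Y \<and> region Z \<subseteq> region Y \<and> card Y \<le> k \<and>
     (\<forall>P. critical G P \<and> region Z \<subseteq> region P \<and> card P \<le> k \<longrightarrow> region P \<subseteq> region Y)"
    using Y(1) by (intro exI[of _ Y]) (simp add: A_def)
  from someI_ex[OF this, folded peak_def]
  show "critical G (peak Z k)" "region Z \<subseteq> region (peak Z k)" "card (peak Z k) \<le> k"
    "critical G P \<Longrightarrow> region Z \<subseteq> region P \<Longrightarrow> card P \<le> k \<Longrightarrow> region P \<subseteq> region (peak Z k)"
    by auto
qed

lemma peak_mono:
  assumes "critical G Z" "card Z \<le> k" "k \<le> j"
  shows "region (peak Z k) \<subseteq> region (peak Z j)"
  using peak_spec(1-3)[OF assms(1,2)] peak_spec(4)[OF assms(1), of j] assms(2,3) by simp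

section \<open>Clusters of nested regions and the pieces cut from them\<close>

definition cluster :: "'a set \<Rightarrow> 'a set" where
  "cluster X = \<Union>{region Y | Y. critical G Y \<and> region X \<subseteq> region Y}"

text \<open>A sequence of peaks depends on where it starts; one fixed start per cluster makes all
  pieces of the cluster come from one sequence.\<close>

definition rep :: "'a set \<Rightarrow> 'a set" where
  "rep X = (SOME Z. critical G Z \<and> cluster Z = cluster X)"

lemma region_subset_cluster: "critical G Y \<Longrightarrow> region X \<subseteq> region Y \<Longrightarrow> region Y \<subseteq> cluster X"
  by (auto simp: cluster_def)

text \<open>A region \<open>W\<close> above \<open>X\<close> is comparable with the common upper
  region of \<open>Y\<close>, and the larger of the two lies above \<open>P\<close>.\<close>

lemma cluster_mono:
  assumes "critical G X" "critical G P" "critical G Y" "region X \<subseteq> region Y" "region P \<subseteq> region Y"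
  shows "cluster X \<subseteq> cluster P"
proof
  fix v assume "v \<in> cluster X"
  then obtain W where W: "critical G W" "region X \<subseteq> region W" "v \<in> region W"
    by (auto simp: cluster_def)
  then have "region W \<subseteq> region Y \<or> region Y \<subseteq> region W"
    using region_comparable[of W Y X] assms by blast
  then show "v \<in> cluster P"
    using W assms(3,5) region_subset_cluster[of W P] region_subset_cluster[of Y P] by blast
qed

text \<open>Two regions through \<open>v\<close> are comparable and the larger one lies above both
  \<open>X\<close> and \<open>P\<close>. Hence clusters are equal or disjoint.\<close>

lemma cluster_eqI:
  assumes "critical G X" "critical G P" "v \<in> cluster X" "v \<in> cluster P"
  obtains Y where "critical G Y" "region X \<subseteq> region Y" "region P \<subseteq> region Y" "cluster X = cluster P"
proof -
  obtain W where W: "critical G W" "region X \<subseteq> region W" "v \<in> region W"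
    using assms(3) by (auto simp: cluster_def)
  obtain W' where W': "critical G W'" "region P \<subseteq> region W'" "v \<in> region W'"
    using assms(4) by (auto simp: cluster_def)
  have "region W \<subseteq> region W' \<or> region W' \<subseteq> region W" using region_laminar W W' by blast
  then obtain Y where "critical G Y" "region X \<subseteq> region Y" "region P \<subseteq> region Y"
    using W W' by blast
  then show thesis using that cluster_mono[of X P Y] cluster_mono[of P X Y] assms(1,2) by blast
qed

lemma rep_spec:
  assumes "critical G X"
  shows "critical G (rep X)" "cluster (rep X) = cluster X"
proof -
  have "critical G X \<and> cluster X = cluster X" using assms by simp
  from someI[where P = "\<lambda>Z. critical G Z \<and> cluster Z = cluster X", OF this, folded rep_def]
  show "critical G (rep X)" "cluster (rep X) = cluster X" by auto
qed

lemma rep_eqI: "critical G X \<Longrightarrow> critical G P \<Longrightarrow> cluster (rep X) = cluster (rep P) \<Longrightarrow> rep X = rep P"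
  using rep_spec(2) by (simp add: rep_def)

text \<open>The sequence starts at \<open>card Z\<close>, the first bound that \<open>Z\<close>
  itself satisfies, with a whole region. Later pieces lose the preceding boundary as well as the
  preceding region, since those boundary vertices may be neighbours of an earlier piece and have to
  stay in the central part.\<close>

definition piece :: "'a set \<Rightarrow> nat \<Rightarrow> 'a set" where
  "piece Z k = (if k \<le> card Z then region (peak Z k)
     else region (peak Z k) - (region (peak Z (k - 1)) \<union> peak Z (k - 1)))"

definition pieces :: "'a set set" where
  "pieces = {piece (rep X) k | X k. critical G X \<and> card (rep X) \<le> k}"

lemma piece_subset: "piece Z k \<subseteq> region (peak Z k)"
  by (auto simp: piece_def)

lemma piece_subset_cluster: "critical G Z \<Longrightarrow> card Z \<le> k \<Longrightarrow> piece Z k \<subseteq> cluster Z"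
  using piece_subset[of Z k] region_subset_cluster[of "peak Z k" Z] peak_spec(1,2) by blast

lemma disjoint_piece:
  assumes "critical G Z" "card Z \<le> k" "k < j"
  shows "region (peak Z k) \<inter> piece Z j = {}"
proof -
  have "k \<le> j - 1" "\<not> j \<le> card Z" using assms(2,3) by auto
  then show ?thesis using peak_mono[OF assms(1,2), of "j - 1"] unfolding piece_def by auto
qed

lemma pieces_disjoint:
  assumes "I \<in> pieces" "J \<in> pieces" "I \<noteq> J"
  shows "I \<inter> J = {}"
proof (rule ccontr)
  assume "I \<inter> J \<noteq> {}"
  then obtain v where v: "v \<in> I" "v \<in> J" by blast
  obtain X k where X: "critical G X" "card (rep X) \<le> k" "I = piece (rep X) k"
    using assms(1) by (auto simp: pieces_def)
  obtain P j where P: "critical G P" "card (rep P) \<le> j" "J = piece (rep P) j"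
    using assms(2) by (auto simp: pieces_def)
  have "v \<in> cluster (rep X)" "v \<in> cluster (rep P)"
    using v X P piece_subset_cluster rep_spec(1) by blast+
  then have eq: "rep X = rep P"
    using cluster_eqI[OF rep_spec(1)[OF X(1)] rep_spec(1)[OF P(1)]] rep_eqI X(1) P(1) by metis
  define Z where "Z = rep X"
  have Z: "critical G Z" "card Z \<le> k" "card Z \<le> j" "I = piece Z k" "J = piece Z j"
    using rep_spec(1)[OF X(1)] X P eq by (auto simp: Z_def)
  then have "k \<noteq> j" using assms(3) by auto
  then consider "k < j" | "j < k" by linarith
  then show False
    using disjoint_piece[OF Z(1,2), of j] disjoint_piece[OF Z(1,3), of k]
      piece_subset[of Z j] piece_subset[of Z k] v Z(4,5) by cases auto
qed

lemma pieces_subset: "I \<in> pieces \<Longrightarrow> I \<subseteq> verts G - U"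
  using piece_subset region_subset by (fastforce simp: pieces_def)

text \<open>A neighbour of the piece is in the current region or on its boundary, and outside the
  preceding region. Not being in the piece, it lies on one of the two boundaries.\<close>

lemma neighbourhood_piece:
  assumes "critical G Z" "card Z \<le> k"
  shows "neighbourhood G (piece Z k) \<subseteq> peak Z k \<union> (if k \<le> card Z then {} else peak Z (k - 1))"
proof
  fix v assume "v \<in> neighbourhood G (piece Z k)"
  then obtain u where u: "u \<in> piece Z k" "adj G u v" "v \<in> verts G" "v \<notin> piece Z k"
    by (auto simp: neighbourhood_def)
  have N: "x \<in> region P \<union> P" if "critical G P" "y \<in> region P" "adj G y x" for x y P
    using neighbourhood_region[OF that(1)] that(2,3) adj_verts[OF graph that(3)]
    by (fastforce simp: neighbourhood_def)
  have 1: "v \<in> region (peak Z k) \<union> peak Z k"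
    using N[OF peak_spec(1)[OF assms]] u(1,2) piece_subset by blast
  show "v \<in> peak Z k \<union> (if k \<le> card Z then {} else peak Z (k - 1))"
  proof (cases "k \<le> card Z")
    case True
    then show ?thesis using 1 u(4) by (simp add: piece_def)
  next
    case False
    then have "critical G (peak Z (k - 1))" using peak_spec(1)[OF assms(1), of "k - 1"] by simp
    then have "v \<notin> region (peak Z (k - 1))"
      using N[of _ v u] u(1,2) adj_sym[of G u v] False by (auto simp: piece_def)
    then show ?thesis using 1 u(4) False by (auto simp: piece_def)
  qed
qed

text \<open>A vertex of \<open>P\<close> inside a good component of \<open>Y\<close> would pull a
  whole good component of \<open>P\<close> that avoids \<open>Y\<close> into it.\<close>

lemma boundary_disjoint_region:
  assumes "critical G P" "critical G Y" "region P \<inter> region Y = {}"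
  shows "P \<inter> region Y = {}"
proof (rule ccontr)
  assume "P \<inter> region Y \<noteq> {}"
  then obtain v D where v: "v \<in> P" "v \<in> D" "D \<in> good_comps Y" by (auto simp: region_def)
  have "finite Y" using assms(2) by (simp add: critical_def)
  then obtain C where C: "C \<in> good_comps P" "C \<inter> Y = {}" using good_comp_avoiding[OF assms(1)] by blast
  have "v \<notin> Y" using v comps_subset[OF good_compsD(2)] by blast
  then have "C \<subseteq> D" using full_comp_subset[OF good_compsD(1)[OF C(1)] C(2)] v good_compsD(2) by blast
  then show False using assms(3) C v comps_nonempty[OF good_compsD(2)[OF C(1)]]
    by (auto simp: region_def)
qed

text \<open>All boundaries have to stay in the centre. Within a cluster, pieces up to index
  \<open>k\<close> lie inside the region bounded by the peak, and later ones have lost a region and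
  boundary that together contain this peak. Regions of different clusters are disjoint.\<close>

lemma peak_disjoint_piece:
  assumes "critical G X" "critical G P" "card (rep X) \<le> k" "card (rep P) \<le> j"
  shows "peak (rep X) k \<inter> piece (rep P) j = {}"
proof (cases "rep X = rep P")
  case True
  define Z where "Z = rep P"
  have Z: "critical G Z" "card Z \<le> k" "card Z \<le> j"
    using rep_spec(1)[OF assms(2)] assms(3,4) True by (auto simp: Z_def)
  have "peak Z k \<inter> piece Z j = {}"
  proof (cases "j \<le> k")
    case True
    then show ?thesis using piece_subset[of Z j] peak_mono[OF Z(1,3) True] region_subset[of "peak Z k"] by blast
  next
    case False
    then have "region (peak Z k) \<subseteq> region (peak Z (j - 1))" using peak_mono[OF Z(1,2), of "j - 1"] by simp
    then have "peak Z k \<subseteq> peak Z (j - 1) \<union> region (peak Z (j - 1))"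
      using region_subset_boundary[of "peak Z k" "peak Z (j - 1)"] peak_spec(1)[OF Z(1)] Z False by simp
    then show ?thesis using Z False by (auto simp: piece_def)
  qed
  then show ?thesis using True by (simp add: Z_def)
next
  case False
  note Z = rep_spec(1)[OF assms(1)] rep_spec(1)[OF assms(2)]
  have "cluster (rep X) \<inter> cluster (rep P) = {}"
    using cluster_eqI[OF Z] rep_eqI[OF assms(1,2)] False by blast
  then have "region (peak (rep X) k) \<inter> region (peak (rep P) j) = {}"
    using region_subset_cluster[OF peak_spec(1,2)[OF Z(1) assms(3)]]
      region_subset_cluster[OF peak_spec(1,2)[OF Z(2) assms(4)]] by blast
  then show ?thesis
    using boundary_disjoint_region[OF peak_spec(1)[OF Z(1) assms(3)] peak_spec(1)[OF Z(2) assms(4)]]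
      piece_subset by blast
qed

lemma pieces_neighbourhood:
  assumes "I \<in> pieces"
  shows "finite (neighbourhood G I)" "J \<in> pieces \<Longrightarrow> neighbourhood G I \<inter> J = {}"
proof -
  obtain X k where X: "critical G X" "card (rep X) \<le> k" "I = piece (rep X) k"
    using assms by (auto simp: pieces_def)
  note Z = rep_spec(1)[OF X(1)]
  have N: "neighbourhood G I \<subseteq> peak (rep X) k \<union> (if k \<le> card (rep X) then {} else peak (rep X) (k - 1))"
    using neighbourhood_piece[OF Z X(2)] X(3) by simp
  have "finite (peak (rep X) j)" if "card (rep X) \<le> j" for j
    using peak_spec(1)[OF Z that] by (simp add: critical_def)
  then have "finite (peak (rep X) k \<union> (if k \<le> card (rep X) then {} else peak (rep X) (k - 1)))"
    using X(2) by simp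
  then show "finite (neighbourhood G I)" using N finite_subset by blast
  assume "J \<in> pieces"
  then obtain P j where P: "critical G P" "card (rep P) \<le> j" "J = piece (rep P) j"
    by (auto simp: pieces_def)
  have "peak (rep X) i \<inter> J = {}" if "card (rep X) \<le> i" for i
    using peak_disjoint_piece[OF X(1) P(1) that P(2)] P(3) by simp
  then have "peak (rep X) k \<inter> J = {}" "\<not> k \<le> card (rep X) \<Longrightarrow> peak (rep X) (k - 1) \<inter> J = {}"
    using X(2) by auto
  then have "(peak (rep X) k \<union> (if k \<le> card (rep X) then {} else peak (rep X) (k - 1))) \<inter> J = {}"
    by (simp add: Int_Un_distrib2)
  then show "neighbourhood G I \<inter> J = {}" using N by blast
qed

section \<open>Full components inside and outside a piece\<close>

lemma cofinite_inside:
  assumes "critical G X" "region X \<subseteq> region P"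
  shows "finite {C \<in> full_comps G X. \<not> C \<subseteq> region P}"
proof (rule finite_subset[OF _ cofinite_good_comps[OF assms(1)]])
  show "{C \<in> full_comps G X. \<not> C \<subseteq> region P} \<subseteq> full_comps G X - good_comps X"
    using assms(2) by (auto simp: region_def)
qed

text \<open>Here \<open>region P\<close> lies in a single component of \<open>G - X\<close> or
  misses \<open>region X\<close>, so it meets at most one good component of
  \<open>X\<close>.\<close>

lemma cofinite_outside:
  assumes "critical G X" "critical G P" "\<not> region X \<subseteq> region P"
  shows "finite {C \<in> full_comps G X. C \<inter> region P \<noteq> {}}"
proof -
  have "X \<noteq> P" using assms(3) by blast
  then consider A where "A \<in> good_comps X" "region P \<subseteq> A" | "region X \<inter> region P = {}"
    using region_trichotomy[OF assms(1,2)] assms(3) by (auto simp: region_def)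
  then obtain A where A: "{C \<in> full_comps G X. C \<inter> region P \<noteq> {}} \<subseteq> insert A (full_comps G X - good_comps X)"
  proof cases
    case (1 A)
    have "C = A" if C: "C \<in> full_comps G X" "C \<inter> region P \<noteq> {}" for C
      using comps_disjoint[OF graph full_compsD(1)[OF C(1)] good_compsD(2)[OF 1(1)]] 1(2) C(2) by blast
    then show thesis using that[of A] by blast
  next
    case 2
    then have "{C \<in> full_comps G X. C \<inter> region P \<noteq> {}} \<subseteq> full_comps G X - good_comps X"
      by (auto simp: region_def)
    \<comment> \<open>There is no exceptional component in this case; the empty set takes the place
      of \<open>A\<close>.\<close>
    then show thesis using that[of "{}"] by blast
  qed
  then show ?thesis using cofinite_good_comps[OF assms(1)] finite_subset by blast
qed

text \<open>The index \<open>k\<close> is the first whose peak covers \<open>region X\<close>. A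
  full component fails to lie in the piece only by leaving the current region, meeting the preceding
  one or meeting its finite boundary, and each of these happens finitely often.\<close>

lemma piece_cofinite:
  assumes "critical G X" "critical G Z" "card Z \<le> k" "region X \<subseteq> region (peak Z k)"
    "k > card Z \<Longrightarrow> \<not> region X \<subseteq> region (peak Z (k - 1))"
  shows "finite {C \<in> full_comps G X. \<not> C \<subseteq> piece Z k}"
proof (cases "k \<le> card Z")
  case True
  then show ?thesis using cofinite_inside[OF assms(1,4)] by (simp add: piece_def)
next
  case False
  define Q where "Q = peak Z (k - 1)"
  have Q: "critical G Q" "finite Q" using peak_spec(1)[OF assms(2), of "k - 1"] False
    by (auto simp: Q_def critical_def)
  have "{C \<in> full_comps G X. \<not> C \<subseteq> piece Z k} \<subseteq> {C \<in> full_comps G X. \<not> C \<subseteq> region (peak Z k)} \<union>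
      {C \<in> full_comps G X. C \<inter> region Q \<noteq> {}} \<union> {C \<in> full_comps G X. C \<inter> Q \<noteq> {}}"
    using False by (auto simp: piece_def Q_def)
  moreover have "finite {C \<in> full_comps G X. C \<inter> region Q \<noteq> {}}"
    using cofinite_outside[OF assms(1) Q(1)] assms(5) False by (simp add: Q_def)
  ultimately show ?thesis
    using cofinite_inside[OF assms(1,4)] finite_full_comps_meeting[OF graph Q(2), of X]
    by (meson finite_UnI finite_subset)
qed

text \<open>The index of the piece is too early to cover \<open>region X\<close>, or so late that
  the preceding region already covers it, or exactly right. This dichotomy is the source of
  tameness.\<close>

lemma pieces_decide:
  assumes "critical G X" "I \<in> pieces"
  shows "finite {C \<in> full_comps G X. \<not> C \<subseteq> I} \<or> finite {C \<in> full_comps G X. C \<inter> I \<noteq> {}}"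
proof -
  obtain P k where P: "critical G P" "card (rep P) \<le> k" "I = piece (rep P) k"
    using assms(2) by (auto simp: pieces_def)
  define Z where "Z = rep P"
  have Z: "critical G Z" "card Z \<le> k" "I = piece Z k"
    using P rep_spec(1)[OF P(1)] by (auto simp: Z_def)
  consider "\<not> region X \<subseteq> region (peak Z k)" | "k > card Z" "region X \<subseteq> region (peak Z (k - 1))"
    | "region X \<subseteq> region (peak Z k)" "k > card Z \<Longrightarrow> \<not> region X \<subseteq> region (peak Z (k - 1))" by blast
  then show ?thesis
  proof cases
    case 1
    have "{C \<in> full_comps G X. C \<inter> I \<noteq> {}} \<subseteq> {C \<in> full_comps G X. C \<inter> region (peak Z k) \<noteq> {}}"
      using piece_subset[of Z k] Z(3) by blast
    then show ?thesis
      using cofinite_outside[OF assms(1) peak_spec(1)[OF Z(1,2)] 1] finite_subset by blast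
  next
    case 2
    have "{C \<in> full_comps G X. C \<inter> I \<noteq> {}} \<subseteq> {C \<in> full_comps G X. \<not> C \<subseteq> region (peak Z (k - 1))}"
      using Z(3) 2(1) by (auto simp: piece_def)
    then show ?thesis using cofinite_inside[OF assms(1) 2(2)] finite_subset by blast
  next
    case 3
    then show ?thesis using piece_cofinite[OF assms(1) Z(1,2)] Z(3) by blast
  qed
qed

lemma pieces_capture:
  assumes "critical G X"
  shows "\<exists>I\<in>pieces. finite {C \<in> full_comps G X. \<not> C \<subseteq> I}"
proof -
  define Z where "Z = rep X"
  have Z: "critical G Z" "cluster Z = cluster X" using rep_spec[OF assms] by (auto simp: Z_def)
  obtain v where v: "v \<in> region X" using region_nonempty[OF assms] by blast
  then have "v \<in> cluster X" using region_subset_cluster[OF assms] by blast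
  then obtain Y where Y: "critical G Y" "region X \<subseteq> region Y" "region Z \<subseteq> region Y"
    using cluster_eqI[OF assms Z(1)] Z(2) by metis
  define Q where "Q k \<longleftrightarrow> card Z \<le> k \<and> region X \<subseteq> region (peak Z k)" for k
  \<comment> \<open>\<open>card Y\<close> makes \<open>Y\<close> a competitor for the peak, and
    \<open>card Z\<close> keeps the index admissible.\<close>
  have "Q (max (card Y) (card Z))"
    using peak_spec(4)[OF Z(1) _ Y(1,3), of "max (card Y) (card Z)"] Y(2) by (auto simp: Q_def)
  define k where "k = (LEAST k. Q k)"
  have "Q k" unfolding k_def by (rule LeastI) fact
  then have k: "card Z \<le> k" "region X \<subseteq> region (peak Z k)" by (auto simp: Q_def)
  have "\<not> region X \<subseteq> region (peak Z (k - 1))" if less: "k > card Z"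
  proof -
    \<comment> \<open>Since \<open>k - 1\<close> is still at least \<open>card Z\<close>, only the
      inclusion in \<open>Q (k - 1)\<close> can fail.\<close>
    have "\<not> Q (k - 1)" by (rule not_less_Least) (use less in \<open>simp add: k_def[symmetric]\<close>)
    then show ?thesis using less by (simp add: Q_def)
  qed
  then have "finite {C \<in> full_comps G X. \<not> C \<subseteq> piece Z k}"
    using piece_cofinite[OF assms Z(1) k] by blast
  moreover have "piece Z k \<in> pieces" using assms k(1) by (auto simp: pieces_def Z_def)
  ultimately show ?thesis by blast
qed

end

section \<open>Star-decompositions\<close>

lemma star_adj:
  assumes "star_with_centre T c"
  shows "adj T u v \<longleftrightarrow> u = c \<and> v \<in> verts T - {c} \<or> v = c \<and> u \<in> verts T - {c}"
  using assms by (auto simp: star_with_centre_def adj_def doubleton_eq_iff)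

lemma adj_delete_edge: "adj (delete_edge T e) u v \<longleftrightarrow> adj T u v \<and> {u, v} \<noteq> e"
  by (auto simp: adj_def delete_edge_def)

lemma star_component_leaf:
  assumes "star_with_centre T c" "l \<in> verts T - {c}"
  shows "component_of (delete_edge T {c, l}) l = {l}"
proof -
  have "w = l" if "(adj (delete_edge T {c, l}))\<^sup>*\<^sup>* l w" for w
    using that
  proof (induction rule: rtranclp_induct)
    case (step y z)
    then show ?case using assms(2) by (auto simp: adj_delete_edge star_adj[OF assms(1)])
  qed simp
  then show ?thesis using assms(2) by (auto simp: component_of_def delete_edge_def)
qed

lemma star_component_centre:
  assumes "star_with_centre T c" "l \<in> verts T - {c}"
  shows "component_of (delete_edge T {c, l}) c = verts T - {l}"
proof
  show "component_of (delete_edge T {c, l}) c \<subseteq> verts T - {l}"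
  proof
    fix w assume w: "w \<in> component_of (delete_edge T {c, l}) c"
    then have "(adj (delete_edge T {c, l}))\<^sup>*\<^sup>* c w" by (simp add: component_of_def)
    then have "w \<noteq> l"
    proof (induction rule: rtranclp_induct)
      case (step y z)
      then show ?case using assms(2) by (auto simp: adj_delete_edge star_adj[OF assms(1)])
    qed (use assms(2) in auto)
    then show "w \<in> verts T - {l}" using w by (simp add: component_of_def delete_edge_def)
  qed
  have "adj (delete_edge T {c, l}) c w" if "w \<in> verts T - {l}" "w \<noteq> c" for w
    using that assms(2) by (auto simp: adj_delete_edge star_adj[OF assms(1)] doubleton_eq_iff)
  then show "verts T - {l} \<subseteq> component_of (delete_edge T {c, l}) c"
    by (auto simp: component_of_def delete_edge_def)
qed

lemma star_edge_side_leaf: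
  "star_with_centre T c \<Longrightarrow> l \<in> verts T - {c} \<Longrightarrow> edge_side T V {c, l} l = V l"
  by (simp add: edge_side_def star_component_leaf)

lemma star_edge_side_centre:
  "star_with_centre T c \<Longrightarrow> l \<in> verts T - {c} \<Longrightarrow>
    edge_side T V {c, l} c = (\<Union>t\<in>verts T - {l}. V t)"
  by (simp add: edge_side_def star_component_centre)

text \<open>An inner vertex of a path has two distinct neighbours, and in a star only the centre has
  those.\<close>

lemma star_path:
  assumes "star_with_centre T c" "path_in T p" "t \<in> set p"
  shows "t = hd p \<or> t = last p \<or> t = c"
proof -
  obtain i where i: "i < length p" "t = p ! i" using assms(3) by (auto simp: in_set_conv_nth)
  have p: "distinct p" "\<And>j. Suc j < length p \<Longrightarrow> adj T (p ! j) (p ! Suc j)"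
    using assms(2) by (auto simp: path_in_def successively_conv_nth)
  show ?thesis
  proof (cases "i = 0 \<or> i = length p - 1")
    case True
    then show ?thesis using i assms(2) by (auto simp: path_in_def hd_conv_nth last_conv_nth)
  next
    case False
    then obtain j where j: "i = Suc j" by (cases i) auto
    have "adj T (p ! j) (p ! i)" "adj T (p ! i) (p ! Suc i)" using p(2) False i j by auto
    moreover have "p ! j \<noteq> p ! Suc i" using p(1) i j False by (simp add: nth_eq_iff_index_eq)
    ultimately show ?thesis using i(2) by (auto simp: star_adj[OF assms(1)])
  qed
qed

lemma star_tree:
  assumes "star_with_centre T c"
  shows "tree T"
  unfolding tree_def
proof (intro conjI)
  have c: "c \<in> verts T" using assms by (simp add: star_with_centre_def)
  show "graph T" using assms by (auto simp: star_with_centre_def graph_def)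
  have *: "(adj T)\<^sup>*\<^sup>* c v" "(adj T)\<^sup>*\<^sup>* v c" if "v \<in> verts T" for v
    using that by (cases "v = c"; auto simp: star_adj[OF assms] intro!: r_into_rtranclp)+
  show "connected_graph T" unfolding connected_graph_def
    using c * rtranclp_trans[of "adj T"] by blast
  show "\<nexists>p. cycle_in T p"
  proof
    assume "\<exists>p. cycle_in T p"
    then obtain p where p: "path_in T p" "length p \<ge> 3" "adj T (last p) (hd p)"
      by (auto simp: cycle_in_def)
    \<comment> \<open>\<open>y\<close> lies between two distinct neighbours and is thus the centre,
      which the closing edge of the cycle misses.\<close>
    obtain x y z q where xyz: "p = x # y # z # q"
      using p(2) by (metis Suc_le_length_iff numeral_3_eq_3)
    then have "adj T x y" "adj T y z" "x \<noteq> z" "x \<noteq> y" "last p \<noteq> y" "last p \<noteq> x"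
      using p(1) by (auto simp: path_in_def)
    then show False using p(3) xyz by (auto simp: star_adj[OF assms])
  qed
qed

section \<open>Tame separations from vertex sets with finite neighbourhood\<close>

lemma neighbourhood_disjoint [simp]: "neighbourhood G I \<inter> I = {}"
  by (auto simp: neighbourhood_def)

text \<open>Edges leaving \<open>I\<close> end in its neighbourhood, so no component of the rest
  straddles \<open>I\<close>. This brings the separation at \<open>I\<close> into the form
  \<open>comps_separation\<close>.\<close>

lemma comps_of_region:
  assumes "graph G" "I \<subseteq> verts G"
  shows "\<Union>{C \<in> comps G (neighbourhood G I). C \<subseteq> I} = I"
proof
  show "I \<subseteq> \<Union>{C \<in> comps G (neighbourhood G I). C \<subseteq> I}"
  proof
    fix v assume v: "v \<in> I"
    then have "v \<in> verts G - neighbourhood G I" using assms(2) by (auto simp: neighbourhood_def)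
    then obtain C where C: "C \<in> comps G (neighbourhood G I)" "v \<in> C"
      using comps_cover[of v G "neighbourhood G I"] by blast
    have "w \<in> I" if "w \<in> C" for w
    proof (rule reach_closed)
      show "reach G (neighbourhood G I) v w" using comps_reach C that by metis
      show "b \<in> I" if "a \<in> I" "adj G a b" "b \<notin> neighbourhood G I" for a b
        using that adj_verts[OF assms(1) that(2)] by (auto simp: neighbourhood_def)
    qed (use v in simp)
    then show "v \<in> \<Union>{C \<in> comps G (neighbourhood G I). C \<subseteq> I}" using C by blast
  qed
qed blast

text \<open>Components with neighbourhood exactly \<open>Y\<close> are full components of
  \<open>Y\<close>; infinitely many on each side would make \<open>Y\<close> critical and contradict
  \<open>decide\<close>.\<close>

lemma tame_separation_region:
  assumes "graph G" "I \<subseteq> verts G" "finite (neighbourhood G I)"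
    and decide: "\<And>X. critical G X \<Longrightarrow>
      finite {C \<in> full_comps G X. \<not> C \<subseteq> I} \<or> finite {C \<in> full_comps G X. C \<inter> I \<noteq> {}}"
  shows "tame_separation G {verts G - I, I \<union> neighbourhood G I}"
proof -
  let ?X = "neighbourhood G I" and ?C = "{C \<in> comps G (neighbourhood G I). C \<subseteq> I}"
  have X: "?X \<subseteq> verts G" by (auto simp: neighbourhood_def)
  have "separation G {verts G - I, I \<union> ?X}"
    unfolding separation_def
  proof (rule exI[of _ "verts G - I"], rule exI[of _ "I \<union> ?X"], intro conjI refl ballI)
    show "verts G - I \<union> (I \<union> ?X) = verts G" using X assms(2) by blast
    fix a b assume "a \<in> verts G - I - (I \<union> ?X)" "b \<in> I \<union> ?X - (verts G - I)"
    then have ab: "a \<in> verts G" "a \<notin> I" "a \<notin> ?X" "b \<in> I" using X by auto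
    show "\<not> adj G a b"
    proof
      assume "adj G a b"
      then have "adj G b a" by (rule adj_sym)
      then have "a \<in> ?X" using ab(1,2,4) by (auto simp: neighbourhood_def)
      then show False using ab(3) by simp
    qed
  qed
  moreover have "\<Inter>{verts G - I, I \<union> ?X} \<subseteq> ?X" by blast
  then have "finite (\<Inter>{verts G - I, I \<union> ?X})" using assms(3) by (rule finite_subset)
  ultimately have "finite_order_separation G {verts G - I, I \<union> ?X}"
    by (simp only: finite_order_separation_def)
  moreover have "{verts G - I, I \<union> ?X} = comps_separation G ?X ?C"
    by (simp only: comps_separation_def comps_of_region[OF assms(1,2)] Un_commute)
  moreover have False
    if Y: "Y \<subseteq> ?X" and inf: "infinite {C \<in> ?C. neighbourhood G C = Y}"
      "infinite {C \<in> comps G ?X - ?C. neighbourhood G C = Y}" for Y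
  proof -
    have full: "C \<in> full_comps G Y" if "C \<in> comps G ?X" "neighbourhood G C = Y" for C
      using comps_neighbourhood[OF assms(1) that(1) _ Y] that(2) by (simp add: full_comps_def)
    have in1: "{C \<in> ?C. neighbourhood G C = Y} \<subseteq> {C \<in> full_comps G Y. C \<inter> I \<noteq> {}}"
      using full comps_nonempty by fastforce
    have in2: "{C \<in> comps G ?X - ?C. neighbourhood G C = Y} \<subseteq> {C \<in> full_comps G Y. \<not> C \<subseteq> I}"
      using full by blast
    have inf': "infinite {C \<in> full_comps G Y. C \<inter> I \<noteq> {}}" "infinite {C \<in> full_comps G Y. \<not> C \<subseteq> I}"
      using inf in1 in2 finite_subset by blast+
    have "{C \<in> full_comps G Y. C \<inter> I \<noteq> {}} \<subseteq> full_comps G Y" by blast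
    then have "infinite (full_comps G Y)" using inf'(1) finite_subset by blast
    then have "critical G Y" using Y X finite_subset[OF Y assms(3)] by (simp add: critical_def)
    then show False using decide inf' by blast
  qed
  ultimately show ?thesis
    using X assms(3) unfolding tame_separation_def
    by (intro conjI exI[of _ ?X] exI[of _ ?C]) blast+
qed

text \<open>The node \<open>None\<close> is the centre and keeps all vertices outside the pieces. As
  neighbourhoods of pieces avoid all pieces, they lie in the central part, and the edge at
  \<open>Some I\<close> has exactly the complement of \<open>I\<close> on its central side.\<close>

lemma star_decomposition_of_pieces:
  fixes G :: "'a ugraph" and \<I> :: "'a set set"
  assumes graph: "graph G" and U: "U \<subseteq> verts G"
    and sub: "\<And>I. I \<in> \<I> \<Longrightarrow> I \<subseteq> verts G - U"
    and disj: "\<And>I J. I \<in> \<I> \<Longrightarrow> J \<in> \<I> \<Longrightarrow> I \<noteq> J \<Longrightarrow> I \<inter> J = {}"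
    and fin: "\<And>I. I \<in> \<I> \<Longrightarrow> finite (neighbourhood G I)"
    and nb: "\<And>I J. I \<in> \<I> \<Longrightarrow> J \<in> \<I> \<Longrightarrow> neighbourhood G I \<inter> J = {}"
    and decide: "\<And>X I. critical G X \<Longrightarrow> I \<in> \<I> \<Longrightarrow>
      finite {C \<in> full_comps G X. \<not> C \<subseteq> I} \<or> finite {C \<in> full_comps G X. C \<inter> I \<noteq> {}}"
    and capture: "\<And>X. critical G X \<Longrightarrow> \<exists>I\<in>\<I>. finite {C \<in> full_comps G X. \<not> C \<subseteq> I}"
  shows "\<exists>(T :: 'a set option ugraph) c V. tame_star_decomposition_for G U T c V"
proof -
  define T :: "'a set option ugraph" where
    "T = \<lparr>verts = insert None (Some ` \<I>), edges = {{None, v} | v. v \<in> Some ` \<I>}\<rparr>"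
  define V where "V t = (case t of None \<Rightarrow> verts G - \<Union>\<I> | Some I \<Rightarrow> I \<union> neighbourhood G I)" for t
  have V: "V None = verts G - \<Union>\<I>" "V (Some I) = I \<union> neighbourhood G I" for I
    by (simp_all add: V_def)
  have verts: "verts T = insert None (Some ` \<I>)" by (simp add: T_def)
  have star: "star_with_centre T None" by (auto simp: star_with_centre_def T_def)
  have nV: "neighbourhood G I \<subseteq> V None" if "I \<in> \<I>" for I
    using nb[OF that] by (auto simp: V neighbourhood_def)
  have cover: "(\<Union>t\<in>verts T. V t) = verts G"
    using sub nV unfolding verts by (force simp: V)
  have decomp: "tree_decomposition G T V"
    unfolding tree_decomposition_def
  proof (intro conjI ballI allI impI)
    show "tree T" by (rule star_tree[OF star])
    show "(\<Union>t\<in>verts T. V t) = verts G" by (rule cover)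
  next
    fix e assume e: "e \<in> edges G"
    then obtain a b where ab: "e = {a, b}" using graph by (metis graph_def card_2_iff)
    then have "adj G a b" "adj G b a" using e by (auto simp: adj_def insert_commute)
    then have ab': "a \<in> verts G" "b \<in> verts G" using adj_verts[OF graph] by blast+
    show "\<exists>t\<in>verts T. e \<subseteq> V t"
    proof (cases "e \<subseteq> V None")
      case False
      then obtain I where I: "I \<in> \<I>" "a \<in> I \<or> b \<in> I" using ab ab' by (auto simp: V)
      then have "e \<subseteq> V (Some I)"
        using ab ab' \<open>adj G a b\<close> \<open>adj G b a\<close> by (auto simp: V neighbourhood_def)
      then show ?thesis using I by (auto simp: verts)
    qed (auto simp: verts)
  next
    fix p t assume p: "path_in T p" and t: "t \<in> set p"
    have ends: "hd p \<in> verts T" "last p \<in> verts T" using p by (auto simp: path_in_def)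
    show "V (hd p) \<inter> V (last p) \<subseteq> V t"
    proof (cases "t = hd p \<or> t = last p")
      case False
      then have "t = None" using star_path[OF star p t] by blast
      \<comment> \<open>The ends are two distinct leaves, and their parts overlap only in
        neighbourhoods of pieces, hence in the centre.\<close>
      then obtain I J where IJ: "hd p = Some I" "last p = Some J" "I \<in> \<I>" "J \<in> \<I>"
        using False ends by (auto simp: verts)
      have "hd p \<noteq> last p"
        using p t False by (cases p) (auto simp: path_in_def split: if_splits)
      then have "I \<inter> J = {}" using IJ disj by auto
      then show ?thesis using IJ nV[OF IJ(3)] nV[OF IJ(4)] \<open>t = None\<close> by (auto simp: V)
    qed auto
  qed
  have side: "edge_side T V {None, Some I} None = verts G - I"
    "edge_side T V {None, Some I} (Some I) = I \<union> neighbourhood G I" if I: "I \<in> \<I>" for I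
  proof -
    have leaf: "Some I \<in> verts T - {None}" using I by (simp add: verts)
    show "edge_side T V {None, Some I} (Some I) = I \<union> neighbourhood G I"
      by (simp add: star_edge_side_leaf[OF star leaf] V)
    have "(\<Union>t\<in>verts T - {Some I}. V t) = verts G - I"
    proof
      have "V t \<subseteq> verts G - I" if t: "t \<in> verts T - {Some I}" for t
      proof (cases t)
        case None
        then show ?thesis using I by (auto simp: V)
      next
        case (Some J)
        then have J: "J \<in> \<I>" "J \<noteq> I" using t by (auto simp: verts)
        then show ?thesis using Some disj[OF J(1) I J(2)] nb[OF J(1) I] sub[OF J(1)]
          by (auto simp: V neighbourhood_def)
      qed
      then show "(\<Union>t\<in>verts T - {Some I}. V t) \<subseteq> verts G - I" by blast
      show "verts G - I \<subseteq> (\<Union>t\<in>verts T - {Some I}. V t)"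
      proof
        fix v assume v: "v \<in> verts G - I"
        show "v \<in> (\<Union>t\<in>verts T - {Some I}. V t)"
        proof (cases "v \<in> V None")
          case True
          then show ?thesis by (auto simp: verts)
        next
          case False
          then obtain J where J: "J \<in> \<I>" "v \<in> J" using v by (auto simp: V)
          then have "Some J \<in> verts T - {Some I}" "v \<in> V (Some J)" using v by (auto simp: verts V)
          then show ?thesis by blast
        qed
      qed
    qed
    then show "edge_side T V {None, Some I} None = verts G - I"
      by (simp add: star_edge_side_centre[OF star leaf])
  qed
  have adjT: "(\<exists>I\<in>\<I>. t\<^sub>1 = None \<and> t\<^sub>2 = Some I) \<or> (\<exists>I\<in>\<I>. t\<^sub>2 = None \<and> t\<^sub>1 = Some I)"
    if "adj T t\<^sub>1 t\<^sub>2" for t\<^sub>1 t\<^sub>2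
    using that star_adj[OF star] by (auto simp: verts)
  have tameI: "tame_separation G {verts G - I, I \<union> neighbourhood G I}" if "I \<in> \<I>" for I
    using tame_separation_region[OF graph _ fin[OF that]] decide that sub by blast
  have tame: "tame_tree_decomposition G T V"
    unfolding tame_tree_decomposition_def
  proof (intro conjI allI impI decomp)
    fix t\<^sub>1 t\<^sub>2 assume "adj T t\<^sub>1 t\<^sub>2"
    then obtain I where I: "I \<in> \<I>" "t\<^sub>1 = None \<and> t\<^sub>2 = Some I \<or> t\<^sub>2 = None \<and> t\<^sub>1 = Some I"
      using adjT by blast
    then have "{edge_side T V {t\<^sub>1, t\<^sub>2} t\<^sub>1, edge_side T V {t\<^sub>1, t\<^sub>2} t\<^sub>2} = {verts G - I, I \<union> neighbourhood G I}"
      using side[OF I(1)] by (auto simp: insert_commute)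
    then show "tame_separation G {edge_side T V {t\<^sub>1, t\<^sub>2} t\<^sub>1, edge_side T V {t\<^sub>1, t\<^sub>2} t\<^sub>2}"
      using tameI[OF I(1)] by simp
  qed
  have lives: "\<exists>l\<in>verts T - {None}. lives_at G T V X l" if X: "critical G X" for X
  proof -
    obtain I where I: "I \<in> \<I>" "finite {C \<in> full_comps G X. \<not> C \<subseteq> I}" using capture[OF X] by blast
    \<comment> \<open>One full component inside \<open>I\<close> suffices to place \<open>X\<close>,
      which is its neighbourhood.\<close>
    have "\<not> full_comps G X \<subseteq> {C \<in> full_comps G X. \<not> C \<subseteq> I}"
      using X I(2) finite_subset by (auto simp: critical_def)
    then obtain C where C: "C \<in> full_comps G X" "C \<subseteq> I" by blast
    have XI: "X \<subseteq> I \<union> neighbourhood G I"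
      using full_compsD(2)[OF C(1)] C(2) by (auto simp: neighbourhood_def)
    have "orients_towards G T V X {t\<^sub>1, t\<^sub>2} t\<^sub>1"
      if t: "adj T t\<^sub>1 t\<^sub>2" "Some I \<in> component_of (delete_edge T {t\<^sub>1, t\<^sub>2}) t\<^sub>1" for t\<^sub>1 t\<^sub>2
    proof -
      consider J where "J \<in> \<I>" "t\<^sub>1 = None" "t\<^sub>2 = Some J" | J where "J \<in> \<I>" "t\<^sub>2 = None" "t\<^sub>1 = Some J"
        using adjT[OF t(1)] by blast
      then show ?thesis
      proof cases
        case (1 J)
        then have "Some J \<in> verts T - {None}" by (simp add: verts)
        then have "J \<noteq> I" using t(2) star_component_centre[OF star] 1 by auto
        then have IJ: "I \<inter> J = {}" "neighbourhood G I \<inter> J = {}" using disj nb I(1) 1(1) by auto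
        have "X \<subseteq> verts G - J" using XI IJ X by (auto simp: critical_def)
        moreover have "{C \<in> full_comps G X. \<not> C \<subseteq> verts G - J} \<subseteq> {C \<in> full_comps G X. \<not> C \<subseteq> I}"
          using IJ sub[OF I(1)] by blast
        then have "finite {C \<in> full_comps G X. \<not> C \<subseteq> verts G - J}" using I(2) finite_subset by blast
        ultimately show ?thesis using 1 side(1)[OF 1(1)] by (simp add: orients_towards_def)
      next
        case (2 J)
        then have "Some J \<in> verts T - {None}" by (simp add: verts)
        then have "J = I" using t(2) star_component_leaf[OF star] 2 by (auto simp: insert_commute)
        moreover have "{C \<in> full_comps G X. \<not> C \<subseteq> I \<union> neighbourhood G I} \<subseteq> {C \<in> full_comps G X. \<not> C \<subseteq> I}"
          by blast
        then have "finite {C \<in> full_comps G X. \<not> C \<subseteq> I \<union> neighbourhood G I}" using I(2) finite_subset by blast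
        ultimately show ?thesis using 2 side(2)[OF 2(1)] XI
          by (simp add: orients_towards_def insert_commute)
      qed
    qed
    moreover have "Some I \<in> verts T - {None}" using I(1) by (simp add: verts)
    ultimately show ?thesis by (auto simp: lives_at_def)
  qed
  have "U \<subseteq> V None" using U sub by (auto simp: V)
  then have "tame_star_decomposition_for G U T None V"
    using tame decomp star lives by (simp add: tame_star_decomposition_for_def star_decomposition_def)
  then show ?thesis by blast
qed

lemma (in finitely_met) tame_star_decomposition_exists:
  assumes "U \<subseteq> verts G"
  shows "\<exists>(T :: 'a set option ugraph) c V. tame_star_decomposition_for G U T c V"
  by (rule star_decomposition_of_pieces[OF graph assms pieces_subset pieces_disjoint
    pieces_neighbourhood pieces_decide pieces_capture])

section \<open>Undominating stars\<close>

text \<open>A walk becomes the required path by cutting back at a repeated vertex and starting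
  afresh at every return to \<open>R\<close>, so the path need not begin at
  \<open>a\<close>.\<close>

lemma rtranclp_path:
  assumes "Q\<^sup>*\<^sup>* a b" "a \<in> R"
  shows "\<exists>p. p \<noteq> [] \<and> distinct p \<and> successively Q p \<and> set p \<inter> R = {hd p} \<and> last p = b \<and>
    set p \<subseteq> {x. Q\<^sup>*\<^sup>* a x}"
  using assms
proof (induction rule: rtranclp_induct)
  case base
  then show ?case by (intro exI[of _ "[a]"]) auto
next
  case (step b c)
  then obtain p where p: "p \<noteq> []" "distinct p" "successively Q p" "set p \<inter> R = {hd p}" "last p = b"
    "set p \<subseteq> {x. Q\<^sup>*\<^sup>* a x}" by blast
  have c: "Q\<^sup>*\<^sup>* a c" using step by (simp add: rtranclp.rtrancl_into_rtrancl)
  consider "c \<in> R" | "c \<in> set p" | "c \<notin> R" "c \<notin> set p" by blast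
  then show ?case
  proof cases
    case 1
    then show ?thesis using c by (intro exI[of _ "[c]"]) auto
  next
    case 2
    then obtain q s where q: "p = q @ c # s" by (auto dest: split_list)
    have "hd (q @ [c]) = hd p" using q by (cases q) auto
    moreover have "hd (q @ [c]) \<in> set (q @ [c])" by (cases q) auto
    ultimately have "set (q @ [c]) \<inter> R = {hd (q @ [c])}" using p(4) q by auto
    moreover have "successively Q (q @ [c])" using p(3) q by (simp add: successively_append_iff)
    ultimately show ?thesis using p q by (intro exI[of _ "q @ [c]"]) auto
  next
    case 3
    have "successively Q (p @ [c])" using p step.hyps by (simp add: successively_append_iff)
    then show ?thesis using p c 3 by (intro exI[of _ "p @ [c]"]) auto
  qed
qed

lemma successively_rtranclp: "successively Q p \<Longrightarrow> x \<in> set p \<Longrightarrow> Q\<^sup>*\<^sup>* (hd p) x"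
proof (induction p)
  case (Cons a p)
  show ?case
  proof (cases "x = a")
    case False
    then have "x \<in> set p" "p \<noteq> []" using Cons by auto
    then have "Q a (hd p)" "Q\<^sup>*\<^sup>* (hd p) x" using Cons by (auto simp: successively_Cons)
    then show ?thesis by (simp add: converse_rtranclp_into_rtranclp)
  qed simp
qed simp

lemma successively_path_graph:
  "edges (path_graph p) \<subseteq> edges G \<longleftrightarrow> successively (adj G) p"
  by (auto simp: path_graph_def successively_conv_nth adj_def)

lemma verts_path_graph [simp]: "verts (path_graph p) = set p"
  by (simp add: path_graph_def)

text \<open>Only finitely many of the disjoint paths meet \<open>X\<close>, and a tail of the ray
  stays in one component. All other teeth lie in the component of their path's first vertex, on an
  initial segment or on this tail.\<close>

lemma finite_comps_meeting_teeth:
  assumes "graph G" "finite X" "comb_with_teeth H D" "subgraph H G"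
  shows "finite {C \<in> comps G X. C \<inter> D \<noteq> {}}"
proof -
  obtain R P where R: "ray R" and P: "\<And>p. p \<in> P \<Longrightarrow> p \<noteq> [] \<and> distinct p \<and> set p \<inter> verts R = {hd p}"
    "pairwise (\<lambda>p q. set p \<inter> set q = {}) P" and H: "H = graph_Union (insert R (path_graph ` P))"
    and D: "D = last ` P"
    using assms(3) unfolding comb_with_teeth_def by blast
  obtain r :: "nat \<Rightarrow> 'a" where r: "inj r" "R = \<lparr>verts = range r, edges = {{r n, r (Suc n)} | n. True}\<rparr>"
    using R by (auto simp: ray_def)
  have "edges R \<subseteq> edges G" "verts H \<subseteq> verts G" and pG: "\<And>p. p \<in> P \<Longrightarrow> edges (path_graph p) \<subseteq> edges G"
    using assms(4) by (auto simp: H graph_Union_def subgraph_def)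
  then have radj: "adj G (r n) (r (Suc n))" for n by (auto simp: r adj_def)
  have HG: "range r \<subseteq> verts G" using \<open>verts H \<subseteq> verts G\<close> by (auto simp: H graph_Union_def r)
  have "finite (r -` X)" by (rule finite_vimageI[OF assms(2) r(1)])
  then obtain N where "\<forall>n\<in>r -` X. n < N" unfolding finite_nat_set_iff_bounded by blast
  then have N: "n < N" if "r n \<in> X" for n using that by blast
  then have NX: "r n \<notin> X" if "n \<ge> N" for n using that by fastforce
  define B where "B = {p \<in> P. set p \<inter> X \<noteq> {}}"
  have "finite B" unfolding B_def
    by (rule finite_disjoint_meeting[OF assms(2)]) (use P(2) in \<open>auto simp: pairwise_def\<close>)
  \<comment> \<open>A finite sample met by every component with a tooth; \<open>r N\<close> stands
    for the whole tail.\<close>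
  define F where "F = last ` B \<union> r ` {..N}"
  have tail: "r n \<in> C" if C: "C \<in> comps G X" "r m \<in> C" and m: "m \<ge> N" and n: "n \<ge> N" for C m n
  proof -
    have "reach G X (r N) (r (N + k))" for k
    proof (induction k)
      case (Suc k)
      then show ?case
        using radj[of "N + k"] NX[of "N + k"] NX[of "N + Suc k"]
        by (auto intro: rtranclp.rtrancl_into_rtrancl)
    qed simp
    then have "reach G X (r N) (r m)" "reach G X (r N) (r n)" using m n le_Suc_ex by metis+
    then have "reach G X (r m) (r n)" using reach_sym rtranclp_trans by metis
    then show ?thesis using comps_absorb[OF assms(1) C] by blast
  qed
  have "C \<inter> F \<noteq> {}" if C: "C \<in> comps G X" "C \<inter> D \<noteq> {}" for C
  proof -
    obtain p where p: "p \<in> P" "last p \<in> C" using C D by blast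
    show ?thesis
    proof (cases "p \<in> B")
      case True
      then show ?thesis using p by (auto simp: F_def)
    next
      case False
      then have "set p \<inter> X = {}" using p(1) by (simp add: B_def)
      moreover have "successively (adj G) p" using pG[OF p(1)] by (simp add: successively_path_graph)
      ultimately have "successively (adj (delete_verts G X)) p"
        unfolding successively_conv_nth by (auto dest: nth_mem Suc_lessD)
      then have "reach G X (hd p) (last p)"
        using successively_rtranclp[of _ p "last p"] P(1)[OF p(1)] by simp
      then have "hd p \<in> C" using comps_absorb[OF assms(1) C(1) p(2)] reach_sym by metis
      moreover have "hd p \<in> range r" using P(1)[OF p(1)] r by auto
      ultimately obtain n where n: "r n \<in> C" by auto
      show ?thesis
      proof (cases "n \<le> N")
        case True
        then show ?thesis using n by (auto simp: F_def)
      next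
        case False
        then have "r N \<in> C" using tail[OF C(1) n, of N] by simp
        then show ?thesis by (auto simp: F_def)
      qed
    qed
  qed
  then have "{C \<in> comps G X. C \<inter> D \<noteq> {}} \<subseteq> {C \<in> comps G X. C \<inter> F \<noteq> {}}" by blast
  moreover have "finite F" using \<open>finite B\<close> by (simp add: F_def)
  ultimately show ?thesis using finite_comps_meeting[OF assms(1), of F X] finite_subset by blast
qed

lemma card_1_eqD: "card A = 1 \<Longrightarrow> x \<in> A \<Longrightarrow> y \<in> A \<Longrightarrow> x = y"
  by (metis card_1_singletonE singletonD)

lemma path_into_comp:
  assumes "graph G" "C \<in> full_comps G X" "x \<in> X" "u \<in> C"
  shows "\<exists>p. path_in G p \<and> hd p = x \<and> last p = u \<and> set p \<subseteq> insert x C"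
proof -
  \<comment> \<open>Only the target of a step has to lie in \<open>C\<close>, so that a path can
    start at \<open>x\<close> outside \<open>C\<close> without ever leaving \<open>C\<close>
    again.\<close>
  let ?Q = "\<lambda>a b. adj G a b \<and> b \<in> C"
  have C: "C \<in> comps G X" "C \<subseteq> verts G - X" using assms(2) comps_subset full_compsD(1) by blast+
  obtain c where c: "c \<in> C" "adj G c x" using full_compsD(3)[OF assms(2,3)] by blast
  have "reach G X c u" using comps_reach[OF C(1) c(1) assms(4)] .
  then have "?Q\<^sup>*\<^sup>* c u \<and> u \<in> C"
  proof (induction rule: rtranclp_induct)
    case (step y z)
    then have "z \<in> C" using comps_adj[OF assms(1) C(1), of y z] by simp
    moreover have "?Q y z" using step \<open>z \<in> C\<close> by simp
    ultimately show ?case using step.IH rtranclp.rtrancl_into_rtrancl[of ?Q c y z] by blast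
  qed (use c in simp)
  then have "?Q\<^sup>*\<^sup>* x u"
    using c adj_sym[of G c x] by (simp add: converse_rtranclp_into_rtranclp)
  then obtain p where p: "p \<noteq> []" "distinct p" "successively ?Q p" "set p \<inter> {x} = {hd p}" "last p = u"
    "set p \<subseteq> {y. ?Q\<^sup>*\<^sup>* x y}"
    using rtranclp_path[of ?Q x u "{x}"] by blast
  have "y \<in> insert x C" if "?Q\<^sup>*\<^sup>* x y" for y using that by (cases rule: rtranclp.cases) auto
  then have "set p \<subseteq> insert x C" using p(6) by blast
  moreover have "successively (adj G) p" using p(3) by (rule successively_mono) auto
  moreover have "x \<in> verts G" using adj_verts[OF assms(1) c(2)] by simp
  ultimately have "path_in G p" using p C(2) by (auto simp: path_in_def)
  moreover have "hd p = x" using p(4) by blast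
  ultimately show ?thesis using p(5) \<open>set p \<subseteq> insert x C\<close> by blast
qed

text \<open>Each leaf lies in its own component of \<open>G - X\<close>, whereas the teeth of a comb
  occupy only finitely many of these components.\<close>

lemma undominating_star_exists:
  assumes "graph G" "connected_graph G" "critical G X"
    and inf: "infinite {C \<in> full_comps G X. C \<inter> U \<noteq> {}}"
  shows "\<exists>S. subgraph S G \<and> star_attached_to S U \<and> \<not> dominating_in G S"
proof -
  define A where "A = {C \<in> full_comps G X. C \<inter> U \<noteq> {}}"
  have A: "C \<in> full_comps G X" "C \<in> comps G X" "C \<subseteq> verts G - X" if "C \<in> A" for C
    using that full_compsD(1)[of C G X] comps_subset[of C G X] by (auto simp: A_def)
  have disj: "C = C'" if "C \<in> A" "C' \<in> A" "v \<in> C" "v \<in> C'" for C C' v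
    using comps_eqI[OF assms(1)] A that by metis
  have finX: "finite X" using assms(3) by (simp add: critical_def)
  \<comment> \<open>With \<open>X\<close> empty, the connected graph would be its own only
    component.\<close>
  have "X \<noteq> {}"
  proof
    assume [simp]: "X = {}"
    have "C = verts G" if C: "C \<in> comps G X" for C
    proof -
      obtain v where v: "v \<in> C" using comps_nonempty[OF C] by blast
      have "C \<subseteq> verts G" using comps_subset[OF C] by simp
      moreover have "w \<in> C" if "w \<in> verts G" for w
        using comps_absorb[OF assms(1) C v, of w] assms(2) that v \<open>C \<subseteq> verts G\<close>
        by (auto simp: connected_graph_def)
      ultimately show ?thesis by blast
    qed
    then have "A \<subseteq> {verts G}" using A(2) by blast
    then show False using inf finite_subset by (auto simp: A_def)
  qed
  then obtain x where x: "x \<in> X" by blast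
  have "\<exists>p. path_in G p \<and> hd p = x \<and> last p \<in> U \<inter> C \<and> set p \<subseteq> insert x C" if "C \<in> A" for C
  proof -
    obtain u where "u \<in> C" "u \<in> U" using \<open>C \<in> A\<close> by (auto simp: A_def)
    then show ?thesis using path_into_comp[OF assms(1) A(1)[OF that] x, of u] by blast
  qed
  then obtain p where p: "\<And>C. C \<in> A \<Longrightarrow> path_in G (p C)" "\<And>C. C \<in> A \<Longrightarrow> hd (p C) = x"
    "\<And>C. C \<in> A \<Longrightarrow> last (p C) \<in> U \<inter> C" "\<And>C. C \<in> A \<Longrightarrow> set (p C) \<subseteq> insert x C" by metis
  define u where "u C = last (p C)" for C
  have u: "u C \<in> U" "u C \<in> C" "u C \<in> set (p C)" "u C \<noteq> x" "x \<notin> C" "x \<in> set (p C)" if "C \<in> A" for C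
    using p[OF that] A(3)[OF that] x by (auto simp: u_def path_in_def)
  have inj: "inj_on u A" using disj u(2) by (metis inj_onI)
  define K where "K = \<lparr>verts = insert x (u ` A), edges = {{x, v} | v. v \<in> u ` A}\<rparr>"
  \<comment> \<open>The paths of a subdivision are indexed by edges; the end \<open>u C\<close> of
    an edge determines \<open>C\<close> and thereby its path.\<close>
  define P where "P e = p (SOME C. C \<in> A \<and> u C \<in> e)" for e
  have P: "P {x, u C} = p C" if "C \<in> A" for C
  proof -
    have "(SOME C'. C' \<in> A \<and> u C' \<in> {x, u C}) = C"
      using that u(4) inj by (intro some_equality) (auto dest: inj_onD)
    then show ?thesis by (simp add: P_def)
  qed
  have edgesK: "edges K = (\<lambda>C. {x, u C}) ` A" by (auto simp: K_def)
  define S where "S = graph_Union (insert \<lparr>verts = verts K, edges = {}\<rparr> ((\<lambda>e. path_graph (P e)) ` edges K))"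
  have vS: "verts S = insert x (\<Union>C\<in>A. set (p C))"
    using u(3) by (auto simp: S_def graph_Union_def edgesK P) (auto simp: K_def)
  have eS: "edges S = (\<Union>C\<in>A. edges (path_graph (p C)))"
    by (auto simp: S_def graph_Union_def edgesK P)
  have "star_with_centre K x" using u(4) by (auto simp: star_with_centre_def K_def)
  moreover have "infinite (verts K)"
    using inf inj by (simp add: K_def A_def[symmetric] finite_image_iff)
  moreover have "subdivision K S"
    unfolding subdivision_def
  proof (rule exI[of _ P], intro conjI ballI S_def)
    fix e assume "e \<in> edges K"
    then obtain C where C: "C \<in> A" "e = {x, u C}" using edgesK by blast
    have Pe: "P e = p C" using P[OF C(1)] C(2) by simp
    show "P e \<noteq> []" "distinct (P e)" using p(1)[OF C(1)] by (simp_all add: Pe path_in_def)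
    show "{hd (P e), last (P e)} = e" unfolding Pe using p(2)[OF C(1)] C(2) by (simp add: u_def)
    have "C' = C" if "C' \<in> A" "u C' \<in> set (p C)" for C'
      using disj[OF that(1) C(1)] u(2,4)[OF that(1)] p(4)[OF C(1)] that by blast
    then have "set (p C) \<inter> verts K = {x, u C}"
      using u(3,6)[OF C(1)] C(1) unfolding K_def by auto
    then show "set (P e) \<inter> verts K = e" unfolding Pe by (simp only: C(2))
  next
    have "set (p C) \<inter> set (p C') \<subseteq> {x}" if "C \<in> A" "C' \<in> A" "C \<noteq> C'" for C C'
      using p(4)[OF that(1)] p(4)[OF that(2)] disj[OF that(1,2)] that(3) by blast
    then show "pairwise (\<lambda>e f. set (P e) \<inter> set (P f) \<subseteq> verts K) (edges K)"
      unfolding edgesK pairwise_def by (auto simp: P K_def)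
  qed
  ultimately have star: "subdivided_infinite_star S" unfolding subdivided_infinite_star_def by blast
  have leaves: "leaves S \<subseteq> u ` A"
  proof
    fix v assume v: "v \<in> leaves S"
    \<comment> \<open>A leaf lies on one edge only. The centre lies on edges into two different
      components, and an inner path vertex lies on two consecutive edges.\<close>
    have uniq: "e = f" if "e \<in> edges S" "f \<in> edges S" "v \<in> e" "v \<in> f" for e f
      using v that card_1_eqD[of "{e \<in> edges S. v \<in> e}" e f] by (simp add: leaves_def)
    have edge: "{p C ! i, p C ! Suc i} \<in> edges S" if "C \<in> A" "Suc i < length (p C)" for C i
      using that by (auto simp: eS path_graph_def)
    have p0: "p C \<noteq> []" "distinct (p C)" if "C \<in> A" for C using p(1)[OF that] by (auto simp: path_in_def)
    have p1: "Suc 0 < length (p C)" "p C ! 0 = x" "p C ! Suc 0 \<in> C" if C: "C \<in> A" for C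
    proof -
      show 0: "p C ! 0 = x" using p(2)[OF C] p0[OF C] by (simp add: hd_conv_nth)
      show len: "Suc 0 < length (p C)"
        using u(4)[OF C] p(2)[OF C] p0(1)[OF C] by (cases "p C") (auto simp: u_def split: if_splits)
      have "0 < length (p C)" using len by (rule Suc_lessD)
      from nth_eq_iff_index_eq[OF p0(2)[OF C] len this] have "p C ! Suc 0 \<noteq> p C ! 0" by simp
      then have "p C ! Suc 0 \<noteq> x" using 0 by simp
      then show "p C ! Suc 0 \<in> C" using p(4)[OF C] nth_mem[OF len] by blast
    qed
    show "v \<in> u ` A"
    proof (cases "v = x")
      case True
      obtain C where C: "C \<in> A" using inf by (metis A_def finite.emptyI ex_in_conv)
      obtain C' where C': "C' \<in> A" "C' \<noteq> C"
        using inf C by (metis A_def finite.emptyI finite_insert finite_subset insert_iff subsetI)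
      have "{p C ! 0, p C ! Suc 0} = {p C' ! 0, p C' ! Suc 0}"
        using uniq[OF edge[OF C p1(1)[OF C]] edge[OF C'(1) p1(1)[OF C'(1)]]]
          p1(2)[OF C] p1(2)[OF C'(1)] True by simp
      then have "p C ! Suc 0 = p C' ! Suc 0" using p1(2)[OF C] p1(2)[OF C'(1)] by (auto simp: doubleton_eq_iff)
      then have "C = C'" using disj[OF C C'(1) p1(3)[OF C]] p1(3)[OF C'(1)] by simp
      then show ?thesis using C'(2) by simp
    next
      case False
      then obtain C where C: "C \<in> A" "v \<in> set (p C)" using v vS by (auto simp: leaves_def)
      obtain i where i: "i < length (p C)" "v = p C ! i" using C(2) by (auto simp: in_set_conv_nth)
      have "i \<noteq> 0" using p1(2)[OF C(1)] i False by metis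
      then obtain j where j: "i = Suc j" by (cases i) auto
      have "Suc i = length (p C)"
      proof (rule ccontr)
        assume "Suc i \<noteq> length (p C)"
        then have "{p C ! j, p C ! Suc j} = {p C ! i, p C ! Suc i}"
          using uniq[OF edge[OF C(1), of j] edge[OF C(1), of i]] i j by simp
        then have "p C ! j = p C ! Suc i" using j by (auto simp: doubleton_eq_iff)
        then show False using p0(2)[OF C(1)] i j \<open>Suc i \<noteq> length (p C)\<close>
          by (simp add: nth_eq_iff_index_eq)
      qed
      then have "i = length (p C) - 1" by simp
      then have "v = u C" using i(2) p0(1)[OF C(1)] by (simp add: u_def last_conv_nth)
      then show ?thesis using C(1) by blast
    qed
  qed
  have "subgraph S G"
  proof -
    have "verts S \<subseteq> verts G"
      using p(1) A(1) assms(3) x by (auto simp: vS path_in_def critical_def)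
    moreover have "edges S \<subseteq> edges G"
      using p(1) successively_path_graph[of _ G] by (auto simp: eS path_in_def)
    moreover have "e \<subseteq> verts S" if "e \<in> edges S" for e
      using that by (auto simp: eS vS path_graph_def)
    then have "graph S" using \<open>edges S \<subseteq> edges G\<close> assms(1) by (auto simp: graph_def)
    ultimately show ?thesis by (simp add: subgraph_def)
  qed
  moreover have "star_attached_to S U"
    using star leaves u(1) by (auto simp: star_attached_to_def)
  moreover have "\<not> dominating_in G S"
  proof
    assume "dominating_in G S"
    then obtain H D where H: "comb_with_teeth H D" "subgraph H G" "infinite (leaves S \<inter> D)"
      by (auto simp: dominating_in_def)
    have "leaves S \<inter> D \<subseteq> u ` {C \<in> comps G X. C \<inter> D \<noteq> {}}"
      using leaves u(2) A(2) by blast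
    then show False
      using finite_comps_meeting_teeth[OF assms(1) finX H(1,2)] H(3) finite_surj by blast
  qed
  ultimately show ?thesis by blast
qed

section \<open>Infinite sets without a comb\<close>

lemma disjoint_sequence:
  assumes "\<And>Y. finite Y \<Longrightarrow> \<exists>p. Q p \<and> set p \<inter> Y = {}"
  shows "\<exists>f :: nat \<Rightarrow> 'a list. \<forall>n. Q (f n) \<and> (\<forall>m<n. set (f n) \<inter> set (f m) = {})"
proof (rule dependent_wellorder_choice)
  fix n :: nat and f :: "nat \<Rightarrow> 'a list"
  show "\<exists>p. Q p \<and> (\<forall>m<n. set p \<inter> set (f m) = {})"
    using assms[of "\<Union>m<n. set (f m)"] by blast
qed simp

lemma reach_path_avoiding:
  assumes "graph G" "reach G Y a b" "a \<in> R" "a \<in> verts G" "a \<notin> Y"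
  obtains p where "path_in G p" "set p \<inter> R = {hd p}" "last p = b" "set p \<inter> Y = {}"
proof -
  obtain p where p: "p \<noteq> []" "distinct p" "successively (adj (delete_verts G Y)) p"
    "set p \<inter> R = {hd p}" "last p = b" "set p \<subseteq> {x. reach G Y a x}"
    using rtranclp_path[OF assms(2,3)] by blast
  have x: "x \<in> verts G - Y" if "x \<in> set p" for x
  proof -
    have "reach G Y a x" using p(6) that by blast
    then show ?thesis using reach_notin[of G Y a x] reach_verts[OF assms(1)] assms(4,5) by blast
  qed
  have "successively (adj G) p" using p(3) by (rule successively_mono) simp
  then have "path_in G p" using p(1,2) x by (auto simp: path_in_def)
  moreover have "set p \<inter> Y = {}" using x by blast
  ultimately show thesis using that p(4,5) by blast
qed

lemma edges_path_graph_subset: "e \<in> edges (path_graph p) \<Longrightarrow> e \<subseteq> set p"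
  by (auto simp: path_graph_def)

text \<open>By \<open>link\<close> no finite set separates the ray from \<open>L\<close>. Hence
  paths to \<open>L\<close> can be chosen greedily, each avoiding the finitely many vertices of the
  earlier ones, and disjointness makes their last vertices distinct.\<close>

lemma comb_exists:
  assumes "graph G" "inj r" and radj: "\<And>n. adj G (r n) (r (Suc n))"
    and link: "\<And>Y. finite Y \<Longrightarrow> \<exists>n. \<exists>u\<in>L. r n \<notin> Y \<and> reach G Y (r n) u"
  shows "\<exists>C D. comb_with_teeth C D \<and> subgraph C G \<and> D \<subseteq> L \<and> infinite D"
proof -
  have rG: "r n \<in> verts G" for n using adj_verts(1)[OF assms(1) radj] .
  have "\<exists>p. (path_in G p \<and> set p \<inter> range r = {hd p} \<and> last p \<in> L) \<and> set p \<inter> Y = {}"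
    if Y: "finite Y" for Y
  proof -
    obtain n u where nu: "u \<in> L" "r n \<notin> Y" "reach G Y (r n) u" using link[OF Y] by blast
    obtain p where "path_in G p" "set p \<inter> range r = {hd p}" "last p = u" "set p \<inter> Y = {}"
      using reach_path_avoiding[OF assms(1) nu(3) _ rG nu(2), of "range r"] by blast
    then show ?thesis using nu(1) by blast
  qed
  then have "\<exists>f. \<forall>n::nat. (path_in G (f n) \<and> set (f n) \<inter> range r = {hd (f n)} \<and> last (f n) \<in> L) \<and>
      (\<forall>m<n. set (f n) \<inter> set (f m) = {})"
    by (rule disjoint_sequence)
  then obtain f where f': "\<forall>n::nat. (path_in G (f n) \<and> set (f n) \<inter> range r = {hd (f n)} \<and> last (f n) \<in> L) \<and>
      (\<forall>m<n. set (f n) \<inter> set (f m) = {})" ..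
  then have f: "\<And>n. path_in G (f n)" "\<And>n. set (f n) \<inter> range r = {hd (f n)}" "\<And>n. last (f n) \<in> L"
    "\<And>m n. m < n \<Longrightarrow> set (f n) \<inter> set (f m) = {}" by simp_all
  have disj: "set (f m) \<inter> set (f n) = {}" if "m \<noteq> n" for m n
    using f(4)[of m n] f(4)[of n m] that by (cases m n rule: linorder_cases) auto
  have ne: "f n \<noteq> []" for n using f(1)[of n] by (simp add: path_in_def)
  have "inj (\<lambda>n. last (f n))"
  proof (rule injI)
    fix m n assume "last (f m) = last (f n)"
    then have "last (f m) \<in> set (f m) \<inter> set (f n)" using ne by (metis IntI last_in_set)
    then show "m = n" using disj[of m n] by auto
  qed
  then have inf: "infinite (range (\<lambda>n. last (f n)))" by (simp add: finite_image_iff)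
  then have inf': "infinite (last ` range f)" by (simp add: image_image)
  define R where "R = \<lparr>verts = range r, edges = {{r n, r (Suc n)} | n. True}\<rparr>"
  define C where "C = graph_Union (insert R (path_graph ` range f))"
  have "comb_with_teeth C (last ` range f)"
    unfolding comb_with_teeth_def
  proof (intro exI conjI ballI)
    show "ray R" using assms(2) by (auto simp: ray_def R_def)
    show "infinite (range f)" using inf' by blast
    show "pairwise (\<lambda>p q. set p \<inter> set q = {}) (range f)"
    proof (rule pairwiseI)
      fix p q assume "p \<in> range f" "q \<in> range f" "p \<noteq> q"
      then obtain m n where "p = f m" "q = f n" "m \<noteq> n" by blast
      then show "set p \<inter> set q = {}" using disj[of m n] by simp
    qed
    show "C = graph_Union (insert R (path_graph ` range f))" by (rule C_def)
    show "last ` range f = last ` range f" ..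
    fix p assume "p \<in> range f"
    then obtain n where "p = f n" by blast
    then show "p \<noteq> []" "distinct p" "set p \<inter> verts R = {hd p}"
      using f(1)[of n] f(2)[of n] by (simp_all add: path_in_def R_def)
  qed
  moreover have "subgraph C G"
  proof -
    have v: "verts C \<subseteq> verts G" using f(1) rG by (auto simp: C_def graph_Union_def R_def path_in_def)
    have "edges (path_graph (f n)) \<subseteq> edges G" for n
      using f(1) by (simp add: successively_path_graph path_in_def)
    then have e: "edges C \<subseteq> edges G" using radj by (auto simp: C_def graph_Union_def R_def adj_def)
    have "e \<subseteq> verts C" if "e \<in> edges C" for e
      using that edges_path_graph_subset[of e] by (fastforce simp: C_def graph_Union_def R_def)
    then have "graph C" using e assms(1) by (auto simp: graph_def)
    then show ?thesis using v e by (simp add: subgraph_def)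
  qed
  ultimately show ?thesis using inf' f(3) by blast
qed

text \<open>In the form inherited by infinite subsets of \<open>L\<close>.\<close>

definition fan :: "'a ugraph \<Rightarrow> 'a \<Rightarrow> 'a set \<Rightarrow> bool" where
  "fan G c L \<longleftrightarrow> infinite L \<and> (\<forall>Y. finite Y \<longrightarrow> c \<notin> Y \<longrightarrow> finite {w \<in> L. \<not> reach G Y c w})"

text \<open>In a breadth-first tree from \<open>s\<close>, a vertex with infinitely many children
  having descendants in \<open>L\<close> is the centre of a fan to one descendant for each child.
  Otherwise Koenig's argument follows infinite sets of descendants down a ray.\<close>

lemma fan_or_ray:
  assumes inf: "infinite L" and L: "\<And>u. u \<in> L \<Longrightarrow> (adj H)\<^sup>*\<^sup>* s u"
  shows "(\<exists>c L'. L' \<subseteq> L \<and> fan H c L') \<or>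
    (\<exists>r :: nat \<Rightarrow> 'a. inj r \<and> (\<forall>n. adj H (r n) (r (Suc n))) \<and>
      (\<forall>Y. finite Y \<longrightarrow> (\<exists>n. \<exists>u\<in>L. r n \<notin> Y \<and> reach H Y (r n) u)))"
proof -
  define d where "d v = (LEAST n. (adj H ^^ n) s v)" for v
  have dI: "(adj H ^^ d v) s v" if v: "(adj H)\<^sup>*\<^sup>* s v" for v
  proof -
    obtain n where "(adj H ^^ n) s v" using v by (auto simp: rtranclp_power)
    then show ?thesis unfolding d_def by (rule LeastI)
  qed
  have d_le: "d v \<le> n" if "(adj H ^^ n) s v" for v n
    unfolding d_def using that by (rule Least_le)
  have "\<exists>w. adj H w v \<and> (adj H)\<^sup>*\<^sup>* s w \<and> d v = Suc (d w)" if v: "(adj H)\<^sup>*\<^sup>* s v" "v \<noteq> s" for v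
  proof -
    obtain m where m: "d v = Suc m" using dI[OF v(1)] v(2) by (cases "d v") auto
    then obtain w where w: "(adj H ^^ m) s w" "adj H w v" using dI[OF v(1)] by auto
    have "(adj H)\<^sup>*\<^sup>* s w" using w(1) by (auto simp: rtranclp_power)
    moreover have "(adj H ^^ Suc (d w)) s v" using dI[OF \<open>(adj H)\<^sup>*\<^sup>* s w\<close>] w(2) by auto
    then have "d v \<le> Suc (d w)" by (rule d_le)
    ultimately show ?thesis using w d_le[OF w(1)] m by (intro exI[of _ w]) simp
  qed
  then obtain par where par: "\<And>v. (adj H)\<^sup>*\<^sup>* s v \<Longrightarrow> v \<noteq> s \<Longrightarrow>
      adj H (par v) v \<and> (adj H)\<^sup>*\<^sup>* s (par v) \<and> d v = Suc (d (par v))" by metis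
  \<comment> \<open>The parent relation of the tree; \<open>d\<close> is the distance from
    \<open>s\<close> and grows by one along each step.\<close>
  define B where "B w v \<longleftrightarrow> (adj H)\<^sup>*\<^sup>* s v \<and> v \<noteq> s \<and> w = par v" for w v
  have B: "adj H w v" "d v = Suc (d w)" if "B w v" for w v
    using that par[of v] by (auto simp: B_def)
  have desc: "B\<^sup>*\<^sup>* s v" if "(adj H)\<^sup>*\<^sup>* s v" for v
    using that
  proof (induction "d v" arbitrary: v rule: less_induct)
    case less
    show ?case
    proof (cases "v = s")
      case False
      then have "B\<^sup>*\<^sup>* s (par v)" using less par[of v] by simp
      moreover have "B (par v) v" using False less.prems by (simp add: B_def)
      ultimately show ?thesis by (rule rtranclp.rtrancl_into_rtrancl)
    qed simp
  qed
  have d_mono: "v = u \<or> d v < d u" if "B\<^sup>*\<^sup>* v u" for v u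
    using that by (induction rule: rtranclp_induct) (auto dest: B(2))
  \<comment> \<open>A vertex has one ancestor at each level, so the subtrees of siblings are
    disjoint.\<close>
  have uniq: "w = w'" if "B\<^sup>*\<^sup>* w u" "B\<^sup>*\<^sup>* w' u" "d w = d w'" for w w' u
    using that
  proof (induction rule: rtranclp_induct)
    case base
    then show ?case using d_mono[of w' w] by auto
  next
    case (step y z)
    from \<open>B\<^sup>*\<^sup>* w' z\<close> show ?case
    proof (cases rule: rtranclp.cases)
      case rtrancl_refl
      then show ?thesis using d_mono[OF step.hyps(1)] B(2)[OF step.hyps(2)] step.prems(2) by auto
    next
      case (rtrancl_into_rtrancl y')
      then have "y' = y" using step.hyps(2) by (simp add: B_def)
      then show ?thesis using rtrancl_into_rtrancl step.IH step.prems(2) by simp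
    qed
  qed
  have avoid: "reach H Y w u" if "B\<^sup>*\<^sup>* w u" "\<And>y. B\<^sup>*\<^sup>* w y \<Longrightarrow> y \<notin> Y" for w u Y
    using that(1)
  proof (induction rule: rtranclp_induct)
    case (step y z)
    have "B\<^sup>*\<^sup>* w z" using step by simp
    then have "adj (delete_verts H Y) y z" using that(2) step.hyps B(1)[OF step.hyps(2)] by simp
    with step.IH show ?case by (rule rtranclp.rtrancl_into_rtrancl)
  qed simp
  define D where "D v = {u \<in> L. B\<^sup>*\<^sup>* v u}" for v
  show ?thesis
  proof (cases "\<exists>v. infinite {w. B v w \<and> D w \<noteq> {}}")
    case True
    then obtain v where inf_v: "infinite {w. B v w \<and> D w \<noteq> {}}" by blast
    define W where "W = {w. B v w \<and> D w \<noteq> {}}"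
    have "\<exists>u. u \<in> L \<and> B\<^sup>*\<^sup>* w u" if "w \<in> W" for w
      using that by (auto simp: W_def D_def)
    then obtain t where t: "\<And>w. w \<in> W \<Longrightarrow> t w \<in> L \<and> B\<^sup>*\<^sup>* w (t w)" by metis
    have same: "w = w'" if "w \<in> W" "w' \<in> W" "B\<^sup>*\<^sup>* w u" "B\<^sup>*\<^sup>* w' u" for w w' u
      using uniq[OF that(3,4)] that(1,2) B(2)[of v w] B(2)[of v w'] by (simp add: W_def)
    have "inj_on t W" using same t by (metis inj_onI)
    then have "infinite (t ` W)" using inf_v by (simp add: finite_image_iff W_def)
    moreover have "finite {x \<in> t ` W. \<not> reach H Y v x}" if Y: "finite Y" "v \<notin> Y" for Y
    proof -
      have "finite {w \<in> W. {y. B\<^sup>*\<^sup>* w y} \<inter> Y \<noteq> {}}"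
        by (rule finite_disjoint_meeting[OF Y(1)]) (use same in blast)
      moreover have "reach H Y v (t w)" if w: "w \<in> W" "{y. B\<^sup>*\<^sup>* w y} \<inter> Y = {}" for w
      proof -
        have "reach H Y w (t w)" using avoid[of w "t w" Y] t[OF w(1)] w(2) by blast
        moreover have "adj (delete_verts H Y) v w" using w Y(2) B(1)[of v w] by (auto simp: W_def)
        ultimately show ?thesis by (rule converse_rtranclp_into_rtranclp[rotated])
      qed
      then have "{x \<in> t ` W. \<not> reach H Y v x} \<subseteq> t ` {w \<in> W. {y. B\<^sup>*\<^sup>* w y} \<inter> Y \<noteq> {}}" by blast
      ultimately show ?thesis using finite_surj by blast
    qed
    ultimately have "fan H v (t ` W)" by (simp add: fan_def)
    moreover have "t ` W \<subseteq> L" using t by blast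
    ultimately show ?thesis by blast
  next
    case False
    have step: "\<exists>w. infinite (D w) \<and> B v w" if v: "infinite (D v)" for v
    proof (rule ccontr)
      assume "\<not> ?thesis"
      then have "finite (\<Union>w\<in>{w. B v w \<and> D w \<noteq> {}}. D w)" using False by auto
      moreover have "D v \<subseteq> insert v (\<Union>w\<in>{w. B v w \<and> D w \<noteq> {}}. D w)"
      proof
        fix u assume u: "u \<in> D v"
        then have "B\<^sup>*\<^sup>* v u" "u \<in> L" by (auto simp: D_def)
        then show "u \<in> insert v (\<Union>w\<in>{w. B v w \<and> D w \<noteq> {}}. D w)"
          by (cases rule: converse_rtranclpE) (auto simp: D_def)
      qed
      ultimately show False using v finite_subset by blast
    qed
    have "D s = L" using desc L by (auto simp: D_def)
    then have "infinite (D s)" using inf by simp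
    then obtain r where r: "\<And>n. infinite (D (r n))" "\<And>n. B (r n) (r (Suc n))"
      using dependent_nat_choice[of "\<lambda>_ v. infinite (D v)" "\<lambda>_. B"] step by blast
    have dr: "d (r n) = d (r 0) + n" for n
      by (induction n) (use B(2)[OF r(2)] in auto)
    have "inj r" using dr by (metis injI add_left_cancel)
    moreover have "\<exists>n. \<exists>u\<in>L. r n \<notin> Y \<and> reach H Y (r n) u" if Y: "finite Y" for Y
    proof -
      \<comment> \<open>All of \<open>Y\<close> has distance less than \<open>n\<close> from
        \<open>s\<close>, whereas the descendants of \<open>r n\<close> have distance at least
        \<open>n\<close>.\<close>
      have "finite (d ` Y)" using Y by simp
      then obtain n where n: "\<forall>x\<in>d ` Y. x < n" unfolding finite_nat_set_iff_bounded by blast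
      have "y \<notin> Y" if "B\<^sup>*\<^sup>* (r n) y" for y
        using d_mono[OF that] dr[of n] n by fastforce
      moreover obtain u where "u \<in> D (r n)" using r(1)[of n] by (metis finite.emptyI ex_in_conv)
      ultimately have "r n \<notin> Y" "u \<in> L" "reach H Y (r n) u" using avoid by (auto simp: D_def)
      then show ?thesis by blast
    qed
    ultimately show ?thesis using B(1)[OF r(2)] by blast
  qed
qed

lemma fan_delete_verts:
  assumes "fan (delete_verts G X) c L"
  shows "fan G c L" "c \<notin> X"
proof -
  have mono: "reach G Y c w" if "reach (delete_verts G X) Y c w" for Y w
    using that by (rule rtranclp_mono[THEN predicate2D, rotated]) auto
  have *: "finite {w \<in> L. \<not> reach (delete_verts G X) Y c w}" if "finite Y" "c \<notin> Y" for Y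
    using assms that by (simp add: fan_def)
  have inf: "infinite L" using assms by (simp add: fan_def)
  have "finite {w \<in> L. \<not> reach G Y c w}" if "finite Y" "c \<notin> Y" for Y
    by (rule finite_subset[OF _ *[OF that]]) (use mono in blast)
  then show "fan G c L" using inf by (simp add: fan_def)
  \<comment> \<open>Adding \<open>c\<close> to the exceptional set leaves some reachable
    \<open>w\<close> different from \<open>c\<close>, and a nontrivial connection in
    \<open>G - X\<close> keeps \<open>c\<close> out of \<open>X\<close>.\<close>
  have "finite (insert c {w \<in> L. \<not> reach (delete_verts G X) {} c w})" using *[of "{}"] by simp
  then obtain w where "w \<in> L" "w \<noteq> c" "reach G X c w"
    using inf by (metis (mono_tags, lifting) delete_verts_empty finite_subset insertCI mem_Collect_eq subsetI)
  then show "c \<notin> X" using reach_notin by metis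
qed

text \<open>\<open>f n\<close> has more than \<open>n\<close> vertices and is a prefix of all later
  paths. So its entry at index \<open>n\<close> is final, and the diagonal sequence runs through all
  the paths.\<close>

lemma ray_of_paths:
  fixes f :: "nat \<Rightarrow> 'a list"
  assumes path: "\<And>n. path_in G (f n)" and ext: "\<And>n. \<exists>q. q \<noteq> [] \<and> f (Suc n) = f n @ q"
  shows "\<exists>r. inj r \<and> (\<forall>n. adj G (r n) (r (Suc n))) \<and> infinite (range (\<lambda>n. last (f n))) \<and>
    range (\<lambda>n. last (f n)) \<subseteq> range r"
proof -
  have ne: "f n \<noteq> []" and dist: "distinct (f n)" for n using path[of n] by (auto simp: path_in_def)
  have len_Suc: "length (f n) < length (f (Suc n))" for n using ext[of n] by auto
  have len: "n < length (f n)" for n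
    by (induction n) (use ne len_Suc in \<open>auto intro: le_less_trans Suc_leI\<close>)
  have len_mono: "length (f m) < length (f n)" if "m < n" for m n
    using lift_Suc_mono_less[of "\<lambda>n. length (f n)"] len_Suc that by blast
  have nth: "f n ! k = f m ! k" if "m \<le> n" "k < length (f m)" for m n k
    using that(1)
  proof (induction n rule: dec_induct)
    case (step n)
    have "k < length (f n)" using len_mono[of m n] step.hyps that(2) by (cases "m = n") auto
    then have "f (Suc n) ! k = f n ! k" using ext[of n] by (auto simp: nth_append)
    then show ?case using step.IH by simp
  qed simp
  define r where "r n = f n ! n" for n
  have r: "f n ! k = r k" if "k < length (f n)" for n k
    using nth[of n k k] nth[of k n k] that len[of k] by (cases "n \<le> k") (auto simp: r_def)
  have "inj r"
  proof (rule injI)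
    fix m n assume eq: "r m = r n"
    have l: "m < length (f (max m n))" "n < length (f (max m n))"
      using len[of "max m n"] by auto
    then have "f (max m n) ! m = f (max m n) ! n" using r eq by simp
    then show "m = n" using nth_eq_iff_index_eq[OF dist l] by blast
  qed
  moreover have "adj G (r n) (r (Suc n))" for n
  proof -
    have "adj G (f (Suc n) ! n) (f (Suc n) ! Suc n)"
      using path[of "Suc n"] len[of "Suc n"] by (simp add: path_in_def successively_conv_nth)
    then show ?thesis using r[of n "Suc n"] r[of "Suc n" "Suc n"] len[of "Suc n"] by simp
  qed
  moreover have last: "last (f n) = r (length (f n) - 1)" for n
    using r[of "length (f n) - 1" n] ne[of n] by (simp add: last_conv_nth)
  have "inj (\<lambda>n. last (f n))"
  proof (rule injI)
    fix m n assume "last (f m) = last (f n)"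
    then have "length (f m) - 1 = length (f n) - 1" using last \<open>inj r\<close> by (simp add: inj_eq)
    then have "length (f m) = length (f n)" using len[of m] len[of n] by linarith
    then show "m = n" using len_mono[of m n] len_mono[of n m] by (cases m n rule: linorder_cases) auto
  qed
  then have "infinite (range (\<lambda>n. last (f n)))" by (simp add: finite_image_iff)
  ultimately show ?thesis using last by (intro exI[of _ r]) auto
qed

text \<open>
  If no finite set has infinitely many components meeting \<open>L\<close>, then either a comb is found at
  once, or fans to a decreasing sequence of subsets of \<open>L\<close> are.  Any two centres of such fans are
  joined outside every finite set avoiding them, so that a ray passes through infinitely many.
\<close>

lemma critical_or_comb:
  assumes "graph G" "connected_graph G" "infinite L" "L \<subseteq> verts G"
  shows "(\<exists>X. critical G X \<and> infinite {C \<in> full_comps G X. C \<inter> L \<noteq> {}}) \<or>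
    (\<exists>C D. comb_with_teeth C D \<and> subgraph C G \<and> D \<subseteq> L \<and> infinite D)"
proof (rule ccontr)
  assume neg: "\<not> ?thesis"
  have no_comb: False
    if "inj r" "\<And>n. adj G (r n) (r (Suc n))"
      "\<And>Y. finite Y \<Longrightarrow> \<exists>n. \<exists>u\<in>L. r n \<notin> Y \<and> reach G Y (r n) u" for r :: "nat \<Rightarrow> 'a"
    using comb_exists[OF assms(1) that] neg by blast
  have fin: "finite {C \<in> comps G X. C \<inter> L \<noteq> {}}" if "finite X" for X
    using infinite_comps_critical[OF assms(1) that] neg by blast
  \<comment> \<open>Finitely many components of \<open>G - X\<close> meet \<open>L\<close>, so one
    contains infinitely many vertices of \<open>M\<close>. Working inside \<open>G - X\<close>
    forces the new centre out of \<open>X\<close>.\<close>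
  have fan_step: "\<exists>c M'. c \<notin> X \<and> M' \<subseteq> M \<and> fan G c M'" if X: "finite X" and M: "M \<subseteq> L" "infinite M" for X M
  proof -
    have "M - X \<subseteq> (\<Union>C\<in>{C \<in> comps G X. C \<inter> L \<noteq> {}}. C \<inter> M)"
    proof
      fix v assume v: "v \<in> M - X"
      then obtain C where "C \<in> comps G X" "v \<in> C" using comps_cover[of v G X] M assms(4) by blast
      then show "v \<in> (\<Union>C\<in>{C \<in> comps G X. C \<inter> L \<noteq> {}}. C \<inter> M)" using v M by blast
    qed
    moreover have "infinite (M - X)" using M X by simp
    ultimately obtain C where C: "C \<in> comps G X" "infinite (C \<inter> M)"
      using fin[OF X] finite_subset by blast
    then obtain s where s: "s \<in> C" using comps_nonempty by blast
    have "(adj (delete_verts G X))\<^sup>*\<^sup>* s u" if "u \<in> C \<inter> M" for u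
      using comps_reach[OF C(1) s] that by blast
    from fan_or_ray[OF C(2) this]
    consider c M' where "M' \<subseteq> C \<inter> M" "fan (delete_verts G X) c M'"
      | r :: "nat \<Rightarrow> 'a" where "inj r" "\<And>n. adj (delete_verts G X) (r n) (r (Suc n))"
        "\<And>Y. finite Y \<Longrightarrow> \<exists>n. \<exists>u\<in>C \<inter> M. r n \<notin> Y \<and> reach (delete_verts G X) Y (r n) u"
      by blast
    then show ?thesis
    proof cases
      case 1
      then have "fan G c M'" "c \<notin> X" using fan_delete_verts[of G X c M'] by auto
      then show ?thesis using 1(1) by blast
    next
      case 2
      have mono: "reach G Y v w" if "reach (delete_verts G X) Y v w" for Y v w
        using that by (rule rtranclp_mono[THEN predicate2D, rotated]) auto
      have "\<exists>n. \<exists>u\<in>L. r n \<notin> Y \<and> reach G Y (r n) u" if "finite Y" for Y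
        using 2(3)[OF that] mono M by blast
      moreover have "adj G (r n) (r (Suc n))" for n using 2(2)[of n] by simp
      ultimately show ?thesis using no_comb[OF 2(1)] by blast
    qed
  qed
  \<comment> \<open>In a state \<open>(X, M, c)\<close> the set \<open>X\<close> collects the
    earlier centres, which makes all centres distinct.\<close>
  define ok where "ok s \<longleftrightarrow> (case s of (X, M, c) \<Rightarrow> finite X \<and> M \<subseteq> L \<and> fan G c M \<and> c \<notin> X)"
    for s :: "'a set \<times> 'a set \<times> 'a"
  define nxt where "nxt s s' \<longleftrightarrow> (case (s, s') of ((X, M, c), (X', M', c')) \<Rightarrow> X' = insert c X \<and> M' \<subseteq> M)"
    for s s' :: "'a set \<times> 'a set \<times> 'a"
  have "\<exists>f. \<forall>n. ok (f n) \<and> nxt (f n) (f (Suc n))"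
  proof (rule dependent_nat_choice)
    obtain c M where "M \<subseteq> L" "fan G c M" using fan_step[of "{}" L] assms(3) by blast
    then have "ok ({}, M, c)" by (simp add: ok_def)
    then show "\<exists>s. ok s" by blast
    fix s assume s: "ok s"
    obtain X M c where [simp]: "s = (X, M, c)" by (cases s)
    have "finite (insert c X)" "M \<subseteq> L" "infinite M" using s by (auto simp: ok_def fan_def)
    then obtain c' M' where "c' \<notin> insert c X" "M' \<subseteq> M" "fan G c' M'" using fan_step by metis
    then have "ok (insert c X, M', c') \<and> nxt s (insert c X, M', c')"
      using \<open>finite (insert c X)\<close> \<open>M \<subseteq> L\<close> by (auto simp: ok_def nxt_def)
    then show "\<exists>s'. ok s' \<and> nxt s s'" by blast
  qed
  then obtain f where f: "\<And>n. ok (f n)" "\<And>n. nxt (f n) (f (Suc n))" by blast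
  define X where "X n = fst (f n)" for n
  define M where "M n = fst (snd (f n))" for n
  define c where "c n = snd (snd (f n))" for n
  have f_eq: "f n = (X n, M n, c n)" for n by (simp add: X_def M_def c_def)
  have M: "M n \<subseteq> L" "fan G (c n) (M n)" and cX: "c n \<notin> X n" for n
    using f(1)[of n] by (auto simp: ok_def f_eq)
  have X_Suc: "X (Suc n) = insert (c n) (X n)" and M_Suc: "M (Suc n) \<subseteq> M n" for n
    using f(2)[of n] by (auto simp: nxt_def f_eq)
  have M_mono: "M j \<subseteq> M i" if "i \<le> j" for i j
    using lift_Suc_antimono_le[of M, OF M_Suc that] .
  have X_mono: "X i \<subseteq> X j" if "i \<le> j" for i j
    using lift_Suc_mono_le[of X, OF _ that] X_Suc by blast
  have c_neq: "c i \<noteq> c j" if "i < j" for i j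
    using X_mono[of "Suc i" j] that X_Suc[of i] cX[of j] by auto
  have "inj c"
    by (rule injI) (metis c_neq linorder_neqE_nat)
  have to_L: "\<exists>w\<in>L. reach G Y (c i) w" if "finite Y" "c i \<notin> Y" for i Y
  proof -
    have "finite {w \<in> M i. \<not> reach G Y (c i) w}" "infinite (M i)" using M(2)[of i] that by (auto simp: fan_def)
    then have "\<not> M i \<subseteq> {w \<in> M i. \<not> reach G Y (c i) w}" using finite_subset by blast
    then show ?thesis using M(1) by blast
  qed
  \<comment> \<open>The later fan goes to a subset of the targets of the earlier one, so almost all
    vertices of \<open>M j\<close> are reached from both centres.\<close>
  have linked_le: "reach G Y (c i) (c j)" if "i \<le> j" "finite Y" "c i \<notin> Y" "c j \<notin> Y" for i j Y
  proof -
    have "finite {w \<in> M i. \<not> reach G Y (c i) w}" "finite {w \<in> M j. \<not> reach G Y (c j) w}" "infinite (M j)"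
      using M(2)[of i] M(2)[of j] that by (auto simp: fan_def)
    then have "\<not> M j \<subseteq> {w \<in> M i. \<not> reach G Y (c i) w} \<union> {w \<in> M j. \<not> reach G Y (c j) w}"
      by (meson finite_UnI finite_subset)
    moreover have "M j \<subseteq> M i" using that(1) by (rule M_mono)
    ultimately obtain w where "reach G Y (c i) w" "reach G Y (c j) w" by blast
    then show ?thesis using reach_sym rtranclp_trans by metis
  qed
  have linked: "reach G Y (c i) (c j)" if "finite Y" "c i \<notin> Y" "c j \<notin> Y" for i j Y
    using linked_le[of i j Y] linked_le[of j i Y] reach_sym[of G Y "c j" "c i"] that
    by (cases "i \<le> j") auto
  have cG: "c i \<in> verts G" for i
  proof -
    obtain w where "w \<in> L" "reach G {} (c i) w" using to_L[of "{}" i] by blast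
    then show ?thesis using reach_verts[OF assms(1) reach_sym] assms(4) by blast
  qed
  have "\<exists>g. \<forall>n. (path_in G (g n) \<and> last (g n) \<in> range c) \<and> (\<exists>q. q \<noteq> [] \<and> g (Suc n) = g n @ q)"
  proof (rule dependent_nat_choice)
    have "path_in G [c 0]" using cG by (simp add: path_in_def)
    then show "\<exists>p. path_in G p \<and> last p \<in> range c" by (intro exI[of _ "[c 0]"]) simp
    fix p assume p: "path_in G p \<and> last p \<in> range c"
    then obtain i where i: "last p = c i" by blast
    have ne: "p \<noteq> []" using p by (simp add: path_in_def)
    have "infinite (range c)" using \<open>inj c\<close> by (simp add: finite_image_iff)
    then have "\<not> range c \<subseteq> set p" using finite_subset by blast
    then obtain j where j: "c j \<notin> set p" by blast
    define Y where "Y = set p - {c i}"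
    have "reach G Y (c i) (c j)" using linked[of Y i j] j by (simp add: Y_def)
    then obtain p' where p': "path_in G p'" "set p' \<inter> {c i} = {hd p'}" "last p' = c j" "set p' \<inter> Y = {}"
      using reach_path_avoiding[OF assms(1) _ _ cG, of Y i "c j" "{c i}"] by (auto simp: Y_def)
    obtain q where q: "p' = c i # q" using p' by (cases p') (auto simp: path_in_def)
    have "c i \<noteq> c j" using j ne i last_in_set by metis
    then have "q \<noteq> []" using p'(3) q by auto
    moreover have "path_in G (p @ q)"
      using p p'(1,4) q i ne \<open>q \<noteq> []\<close>
      by (auto simp: path_in_def successively_append_iff successively_Cons Y_def)
    moreover have "last (p @ q) = c j" using \<open>q \<noteq> []\<close> p'(3) q by simp
    ultimately show "\<exists>p'. (path_in G p' \<and> last p' \<in> range c) \<and> (\<exists>q. q \<noteq> [] \<and> p' = p @ q)" by blast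
  qed
  then obtain g where g: "\<And>n. path_in G (g n)" "\<And>n. last (g n) \<in> range c"
    "\<And>n. \<exists>q. q \<noteq> [] \<and> g (Suc n) = g n @ q" by blast
  obtain r where r: "inj r" "\<And>n. adj G (r n) (r (Suc n))" "infinite (range (\<lambda>n. last (g n)))"
    "range (\<lambda>n. last (g n)) \<subseteq> range r" using ray_of_paths[of G g, OF g(1,3)] by blast
  \<comment> \<open>Infinitely many centres lie on the ray, and any of them outside \<open>Y\<close>
    still reaches \<open>L\<close>.\<close>
  have "\<exists>n. \<exists>u\<in>L. r n \<notin> Y \<and> reach G Y (r n) u" if Y: "finite Y" for Y
  proof -
    have "\<not> range (\<lambda>n. last (g n)) \<subseteq> Y" using r(3) Y finite_subset by blast
    then obtain n where n: "last (g n) \<notin> Y" by blast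
    obtain i where i: "last (g n) = c i" using g(2)[of n] by blast
    obtain k where "last (g n) = r k" using r(4) by blast
    then show ?thesis using to_L[OF Y, of i] i n by metis
  qed
  then show False using no_comb[OF r(1,2)] by blast
qed

section \<open>Why the two alternatives exclude each other\<close>

lemma infinite_leaves:
  assumes "subdivided_infinite_star S"
  shows "infinite (leaves S)"
proof -
  obtain K c where K: "star_with_centre K c" "infinite (verts K)" "subdivision K S"
    using assms by (auto simp: subdivided_infinite_star_def)
  obtain P where P: "\<forall>e\<in>edges K. P e \<noteq> [] \<and> distinct (P e) \<and> {hd (P e), last (P e)} = e \<and>
        set (P e) \<inter> verts K = e"
    and S: "S = graph_Union (insert \<lparr>verts = verts K, edges = {}\<rparr> ((\<lambda>e. path_graph (P e)) ` edges K))"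
    using K(3) unfolding subdivision_def by (elim exE conjE) (rule that)
  have edgesK: "edges K = {{c, v} | v. v \<in> verts K - {c}}" using K(1) by (simp add: star_with_centre_def)
  have eS: "edges S = (\<Union>e\<in>edges K. edges (path_graph (P e)))" by (auto simp: S graph_Union_def)
  \<comment> \<open>A branch vertex \<open>v\<close> other than the centre lies only on the path
    replacing \<open>{c, v}\<close>, and it is an end of it.\<close>
  have "v \<in> leaves S" if v: "v \<in> verts K - {c}" for v
  proof -
    define p where "p = P {c, v}"
    have "{c, v} \<in> edges K" using v edgesK by blast
    then have p: "p \<noteq> []" "distinct p" "{hd p, last p} = {c, v}" using P by (auto simp: p_def)
    have other: "e = {c, v}" if "e \<in> edges K" "v \<in> set (P e)" for e
    proof -
      have "v \<in> e" using bspec[OF P that(1)] that(2) v by blast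
      then show ?thesis using that(1) v edgesK by auto
    qed
    have "{e \<in> edges S. v \<in> e} = {e \<in> edges (path_graph p). v \<in> e}"
    proof
      show "{e \<in> edges S. v \<in> e} \<subseteq> {e \<in> edges (path_graph p). v \<in> e}"
      proof
        fix f assume f: "f \<in> {e \<in> edges S. v \<in> e}"
        then obtain e where e: "e \<in> edges K" "f \<in> edges (path_graph (P e))" by (auto simp: eS)
        then have "f \<subseteq> set (P e)" by (auto simp: path_graph_def)
        then have "e = {c, v}" using other e(1) f by blast
        then show "f \<in> {e \<in> edges (path_graph p). v \<in> e}" using e(2) f by (simp add: p_def)
      qed
      show "{e \<in> edges (path_graph p). v \<in> e} \<subseteq> {e \<in> edges S. v \<in> e}"
        using \<open>{c, v} \<in> edges K\<close> by (auto simp: eS p_def)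
    qed
    moreover have "\<exists>f. {e \<in> edges (path_graph p). v \<in> e} = {f}"
    proof -
      \<comment> \<open>Only the set of ends of the path is prescribed, so \<open>v\<close> may come
        first or last.\<close>
      have ends: "p ! 0 = v \<or> p ! (length p - 1) = v" "hd p \<noteq> last p"
        using p(1,3) v by (auto simp: hd_conv_nth last_conv_nth doubleton_eq_iff)
      have "length p \<noteq> 1" using ends(2) by (cases p) auto
      moreover have "length p \<noteq> 0" using p(1) by simp
      ultimately have len: "length p \<ge> 2" by linarith
      have idx: "p ! i = p ! j \<longleftrightarrow> i = j" if "i < length p" "j < length p" for i j
        using nth_eq_iff_index_eq[OF p(2) that] .
      show ?thesis
      proof (cases "p ! 0 = v")
        case True
        have i0: "i = 0" if i: "Suc i < length p" "v \<in> {p ! i, p ! Suc i}" for i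
        proof -
          have "p ! 0 = p ! i \<longleftrightarrow> 0 = i" "p ! 0 = p ! Suc i \<longleftrightarrow> 0 = Suc i"
            by (rule idx; use i(1) len in linarith)+
          then show ?thesis using i(2) True by blast
        qed
        have "{e \<in> edges (path_graph p). v \<in> e} = {{p ! 0, p ! Suc 0}}"
        proof
          show "{e \<in> edges (path_graph p). v \<in> e} \<subseteq> {{p ! 0, p ! Suc 0}}"
            using i0 unfolding path_graph_def by fastforce
          have "Suc 0 < length p" using len by linarith
          then show "{{p ! 0, p ! Suc 0}} \<subseteq> {e \<in> edges (path_graph p). v \<in> e}"
            using True unfolding path_graph_def by auto
        qed
        then show ?thesis by blast
      next
        case False
        \<comment> \<open>The index of the last edge, which joins \<open>p ! k\<close> to
          \<open>p ! Suc k\<close>.\<close>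
        define k where "k = length p - 2"
        have k: "Suc (Suc k) = length p" using len by (simp add: k_def)
        then have kv: "p ! Suc k = v" using ends(1) False by (metis diff_Suc_1)
        have ik: "i = k" if i: "Suc i < length p" "v \<in> {p ! i, p ! Suc i}" for i
        proof -
          have "p ! Suc k = p ! i \<longleftrightarrow> Suc k = i" "p ! Suc k = p ! Suc i \<longleftrightarrow> Suc k = Suc i"
            by (rule idx; use i(1) k in linarith)+
          moreover have "Suc k \<noteq> i" using i(1) k by linarith
          ultimately show ?thesis using i(2) kv by blast
        qed
        have "{e \<in> edges (path_graph p). v \<in> e} = {{p ! k, p ! Suc k}}"
        proof
          show "{e \<in> edges (path_graph p). v \<in> e} \<subseteq> {{p ! k, p ! Suc k}}"
            using ik unfolding path_graph_def by fastforce
          have "Suc k < length p" using k by linarith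
          then show "{{p ! k, p ! Suc k}} \<subseteq> {e \<in> edges (path_graph p). v \<in> e}"
            using kv unfolding path_graph_def by auto
        qed
        then show ?thesis by blast
      qed
    qed
    ultimately obtain f where f: "{e \<in> edges S. v \<in> e} = {f}" by (elim exE) (simp only:)
    have "card {e \<in> edges S. v \<in> e} = 1" unfolding f by simp
    moreover have "v \<in> verts S" using v by (auto simp: S graph_Union_def)
    ultimately show ?thesis by (simp add: leaves_def)
  qed
  then have "verts K - {c} \<subseteq> leaves S" by blast
  then show ?thesis using K(2) finite_subset by fastforce
qed

lemma critical_meets_centre_finitely:
  assumes graph: "graph G" and D: "tame_star_decomposition_for G U T c V" and X: "critical G X"
  shows "finite {C \<in> full_comps G X. C \<inter> U \<noteq> {}}"
proof -
  have star: "star_with_centre T c" and tame: "tame_tree_decomposition G T V" and U: "U \<subseteq> V c"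
    using D by (auto simp: tame_star_decomposition_for_def star_decomposition_def)
  obtain l where l: "l \<in> verts T - {c}" "lives_at G T V X l"
    using D X by (auto simp: tame_star_decomposition_for_def)
  have adj: "adj T l c" using l(1) star_adj[OF star] by auto
  have sides: "edge_side T V {l, c} l = V l" "edge_side T V {l, c} c = (\<Union>t\<in>verts T - {l}. V t)"
    using star_edge_side_leaf[OF star l(1)] star_edge_side_centre[OF star l(1)]
    by (simp_all add: insert_commute)
  have "tame_separation G {V l, \<Union>t\<in>verts T - {l}. V t}"
    using tame adj unfolding tame_tree_decomposition_def sides[symmetric] by blast
  then have "finite (\<Inter>{V l, \<Union>t\<in>verts T - {l}. V t})"
    by (simp only: tame_separation_def finite_order_separation_def)
  \<comment> \<open>The centre is on the far side of the edge at \<open>l\<close>, so this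
    intersection lies in the finite separator.\<close>
  moreover have "V l \<inter> V c \<subseteq> \<Inter>{V l, \<Union>t\<in>verts T - {l}. V t}"
    using l(1) star by (auto simp: star_with_centre_def)
  ultimately have fin: "finite (V l \<inter> V c)" using finite_subset by blast
  have "l \<in> component_of (delete_edge T {l, c}) l"
    using star_component_leaf[OF star l(1)] by (simp add: insert_commute)
  then have "orients_towards G T V X {l, c} l" using l(2) adj by (simp add: lives_at_def)
  then have "finite {C \<in> full_comps G X. \<not> C \<subseteq> V l}" by (simp add: orients_towards_def sides)
  moreover have "{C \<in> full_comps G X. C \<inter> U \<noteq> {}} \<subseteq>
      {C \<in> full_comps G X. \<not> C \<subseteq> V l} \<union> {C \<in> full_comps G X. C \<inter> (V l \<inter> V c) \<noteq> {}}"
    using U by blast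
  ultimately show ?thesis using finite_full_comps_meeting[OF graph fin, of X] finite_subset by blast
qed

(* "Exactly one of (i) and (ii)".  The decomposition star in (ii) may have arbitrary nodes, but an
   existential quantifier in HOL ranges over one type.  Hence "at least one" is asserted with nodes
   taken from the specific type 'a set option, and "not both" for every node type 'b. *)
theorem theorem2:
  fixes G :: "'a ugraph" and U :: "'a set"
  assumes "graph G" and "connected_graph G" and "U \<subseteq> verts G"
  shows "((\<exists>S. subgraph S G \<and> star_attached_to S U \<and> \<not> dominating_in G S) \<or>
          (\<exists>(T :: 'a set option ugraph) c V. tame_star_decomposition_for G U T c V)) \<and>
         \<not> ((\<exists>S. subgraph S G \<and> star_attached_to S U \<and> \<not> dominating_in G S) \<and>
          (\<exists>(T :: 'b ugraph) c V. tame_star_decomposition_for G U T c V))"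
proof (intro conjI notI)
  show "(\<exists>S. subgraph S G \<and> star_attached_to S U \<and> \<not> dominating_in G S) \<or>
      (\<exists>(T :: 'a set option ugraph) c V. tame_star_decomposition_for G U T c V)"
  proof (cases "\<forall>X. critical G X \<longrightarrow> finite {C \<in> full_comps G X. C \<inter> U \<noteq> {}}")
    case True
    then interpret finitely_met G U using assms by unfold_locales auto
    show ?thesis using tame_star_decomposition_exists[OF assms(3)] by blast
  next
    case False
    then show ?thesis using undominating_star_exists[OF assms(1,2)] by blast
  qed
next
  assume "(\<exists>S. subgraph S G \<and> star_attached_to S U \<and> \<not> dominating_in G S) \<and>
    (\<exists>(T :: 'b ugraph) c V. tame_star_decomposition_for G U T c V)"
  then obtain S and T :: "'b ugraph" and c V
    where S: "star_attached_to S U" "\<not> dominating_in G S"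
      and D: "tame_star_decomposition_for G U T c V" by blast
  have L: "leaves S \<subseteq> U" "infinite (leaves S)"
    using S(1) infinite_leaves by (auto simp: star_attached_to_def)
  \<comment> \<open>An infinite set of teeth inside \<open>leaves S\<close> is its own intersection
    with the leaves, so such a comb would be dominated by \<open>S\<close>.\<close>
  have "\<not> (\<exists>C D. comb_with_teeth C D \<and> subgraph C G \<and> D \<subseteq> leaves S \<and> infinite D)"
    using S(2) unfolding dominating_in_def by (metis inf.absorb2)
  then obtain X where X: "critical G X" "infinite {C \<in> full_comps G X. C \<inter> leaves S \<noteq> {}}"
    using critical_or_comb[OF assms(1,2) L(2)] L(1) assms(3) by blast
  have "{C \<in> full_comps G X. C \<inter> leaves S \<noteq> {}} \<subseteq> {C \<in> full_comps G X. C \<inter> U \<noteq> {}}"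
    using L(1) by blast
  then show False
    using critical_meets_centre_finitely[OF assms(1) D X(1)] X(2) finite_subset by blast
qed

end
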